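(* Let $2\le p\le\infty$. There exist constants $\delta'>0$ and $C'>0$, depending only on the unperturbed chain (that is, on $P$ and its invariant density $\hat\pi$), on $D$ and on $p$, but not on $Q$, such that if $P,Q\in L^p(D\times D)$ and $\|P-Q\|_{p}<\delta'$, then $$\|\hat\pi-\hat\eta\|_{p}\le C'\,\|P-Q\|_{p}.$$
   Context: Let $D\subset\mathbb R^d$ be a Borel set with finite positive Lebesgue measure. Let $P(x,y)$ and $Q(x,y)$ be transition densities on $D$: nonnegative measurable functions on $D\times D$ with $\int_D P(x,y)\,dy=\int_D Q(x,y)\,dy=1$ for every $x\in D$; $P(x,A)=\int_A P(x,y)\,dy$, and similarly for $Q$. Let $T$ and $S$ be the associated transition operators: on probability measures, $T\mu(A)=\int_D P(x,A)\mu(dx)$, $S\mu(A)=\int_D Q(x,A)\mu(dx)$; on functions, $Tf(y)=\int_D P(x,y)f(x)\,dx$, $Sf(y)=\int_D Q(x,y)f(x)\,dx$. Standing assumptions: (1) the chains with transition densities $P$ and $Q$ have unique invariant probability measures $\pi$ and $\eta$ respectively ($T\pi=\pi$, $S\eta=\eta$), which are absolutely continuous with densities $\hat\pi$ and $\hat\eta$; (2) both chains are ergodic (not necessarily uniformly ergodic), i.e. $\sup_{C}|P^n(x,C)-\pi(C)|\to0$ for $\pi$-a.e. $x$ and $\sup_C|Q^n(x,C)-\eta(C)|\to0$ for $\eta$-a.e. $x$, where $P^n,Q^n$ are the $n$-step transition probabilities and $C$ ranges over Borel subsets of $D$; (3) $\hat\pi,\hat\eta\in L^2(D)$. Norms $\|\cdot\|_p$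 of $P-Q$ are taken in $L^p(D\times D)$, and those of $\hat\pi-\hat\eta$ in $L^p(D)$. *)

theory Defs
  imports "HOL-Probability.Probability"
begin

text \<open>
  A function \<open>P x y\<close> of type \<open>'a \<Rightarrow> 'a \<Rightarrow> real\<close> only matters for \<open>x, y \<in> D\<close>: every
  measurability condition, integral and norm below refers to Lebesgue measure on \<open>D\<close> or to its
  product with itself. Measurability is Borel measurability.
\<close>

abbreviation leb_on :: "'a::euclidean_space set \<Rightarrow> 'a measure" where
  "leb_on D \<equiv> restrict_space lborel D"

definition transition_density :: "'a::euclidean_space set \<Rightarrow> ('a \<Rightarrow> 'a \<Rightarrow> real) \<Rightarrow> bool" where
  "transition_density D P \<longleftrightarrow>
     case_prod P \<in> borel_measurable (leb_on D \<Otimes>\<^sub>M leb_on D) \<and>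
     (\<forall>x\<in>D. \<forall>y\<in>D. 0 \<le> P x y) \<and>
     (\<forall>x\<in>D. (\<integral>\<^sup>+y. ennreal (P x y) \<partial>leb_on D) = 1)"

definition transition_kernel ::
    "'a::euclidean_space set \<Rightarrow> ('a \<Rightarrow> 'a \<Rightarrow> real) \<Rightarrow> 'a \<Rightarrow> 'a measure" where
  "transition_kernel D P x = density (leb_on D) (\<lambda>y. ennreal (P x y))"

definition transition_op ::
    "'a::euclidean_space set \<Rightarrow> ('a \<Rightarrow> 'a \<Rightarrow> real) \<Rightarrow> 'a measure \<Rightarrow> 'a measure" where
  "transition_op D P \<mu> = \<mu> \<bind> transition_kernel D P"

definition n_step ::
    "'a::euclidean_space set \<Rightarrow> ('a \<Rightarrow> 'a \<Rightarrow> real) \<Rightarrow> nat \<Rightarrow> 'a \<Rightarrow> 'a measure" where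
  "n_step D P n x = (transition_op D P ^^ n) (return (leb_on D) x)"

definition invariant_prob ::
    "'a::euclidean_space set \<Rightarrow> ('a \<Rightarrow> 'a \<Rightarrow> real) \<Rightarrow> 'a measure \<Rightarrow> bool" where
  "invariant_prob D P \<mu> \<longleftrightarrow>
     prob_space \<mu> \<and> sets \<mu> = sets (leb_on D) \<and> transition_op D P \<mu> = \<mu>"

definition unique_invariant_prob ::
    "'a::euclidean_space set \<Rightarrow> ('a \<Rightarrow> 'a \<Rightarrow> real) \<Rightarrow> 'a measure \<Rightarrow> bool" where
  "unique_invariant_prob D P \<mu> \<longleftrightarrow>
     invariant_prob D P \<mu> \<and> (\<forall>\<nu>. invariant_prob D P \<nu> \<longrightarrow> \<nu> = \<mu>)"

definition ergodic_chain ::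
    "'a::euclidean_space set \<Rightarrow> ('a \<Rightarrow> 'a \<Rightarrow> real) \<Rightarrow> 'a measure \<Rightarrow> bool" where
  "ergodic_chain D P \<mu> \<longleftrightarrow>
     (AE x in \<mu>. (\<lambda>n. SUP C\<in>sets (leb_on D). \<bar>measure (n_step D P n x) C - measure \<mu> C\<bar>)
                   \<longlonglongrightarrow> 0)"

text \<open>
  The density is nonnegative only almost everywhere. The condition cannot be dropped, because
  \<^const>\<open>ennreal\<close> truncates negative values to \<open>0\<close>.
\<close>
definition has_leb_density ::
    "'a::euclidean_space set \<Rightarrow> 'a measure \<Rightarrow> ('a \<Rightarrow> real) \<Rightarrow> bool" where
  "has_leb_density D \<mu> h \<longleftrightarrow>
     h \<in> borel_measurable (leb_on D) \<and> (AE x in leb_on D. 0 \<le> h x) \<and>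
     \<mu> = density (leb_on D) (\<lambda>x. ennreal (h x))"

text \<open>
  Extended-valued norm for \<open>1 \<le> p \<le> \<infinity>\<close>; the middle case is needed because \<^const>\<open>enn2real\<close>
  sends \<open>\<infinity>\<close> to \<open>0\<close>.
\<close>
definition Lp_norm :: "'b measure \<Rightarrow> ennreal \<Rightarrow> ('b \<Rightarrow> real) \<Rightarrow> ennreal" where
  "Lp_norm M p f =
     (if p = \<infinity> then esssup M (\<lambda>x. ennreal \<bar>f x\<bar>)
      else let I = (\<integral>\<^sup>+x. ennreal (\<bar>f x\<bar> powr enn2real p) \<partial>M) in
        if I = \<infinity> then \<infinity> else ennreal (enn2real I powr (1 / enn2real p)))"

definition Lp_space :: "'b measure \<Rightarrow> ennreal \<Rightarrow> ('b \<Rightarrow> real) set" where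
  "Lp_space M p = {f \<in> borel_measurable M. Lp_norm M p f < \<infinity>}"

text \<open>
  The Giry-monad definitions agree with the usual formulas
  \<open>T \<mu> (A) = \<integral> P(x, A) \<mu>(dx)\<close> and \<open>P\<^sup>n\<^sup>+\<^sup>1(x, A) = \<integral> P(z, A) P\<^sup>n(x, dz)\<close>.
\<close>

lemma measurable_transition_kernel:
  assumes "D \<in> sets borel" "transition_density D P"
  shows "transition_kernel D P \<in> leb_on D \<rightarrow>\<^sub>M prob_algebra (leb_on D)"
proof -
  have meas [measurable]: "case_prod P \<in> borel_measurable (leb_on D \<Otimes>\<^sub>M leb_on D)"
    using assms(2) by (simp add: transition_density_def)
  have sec [measurable]: "P x \<in> borel_measurable (leb_on D)" if "x \<in> D" for x
    using measurable_Pair2[OF meas, of x] that by (simp add: space_restrict_space)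
  interpret sigma_finite_measure "leb_on D"
    by (rule sigma_finite_measure_restrict_space)
       (use assms(1) in \<open>simp_all add: lborel.sigma_finite_measure_axioms\<close>)
  have prob: "prob_space (transition_kernel D P x)" if "x \<in> D" for x
  proof (rule prob_spaceI)
    have "emeasure (transition_kernel D P x) (space (leb_on D)) =
        (\<integral>\<^sup>+y. ennreal (P x y) * indicator (space (leb_on D)) y \<partial>leb_on D)"
      unfolding transition_kernel_def by (rule emeasure_density) (use sec[OF that] in auto)
    also have "\<dots> = (\<integral>\<^sup>+y. ennreal (P x y) \<partial>leb_on D)"
      by (intro nn_integral_cong) simp
    also have "\<dots> = 1"
      using assms(2) that by (simp add: transition_density_def)
    finally show "emeasure (transition_kernel D P x) (space (transition_kernel D P x)) = 1"
      by (simp add: transition_kernel_def)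
  qed
  show ?thesis
  proof (rule measurable_prob_algebraI)
    show "transition_kernel D P \<in> leb_on D \<rightarrow>\<^sub>M subprob_algebra (leb_on D)"
    proof (rule measurable_subprob_algebra)
      fix A assume A [measurable]: "A \<in> sets (leb_on D)"
      have "(\<lambda>x. \<integral>\<^sup>+y. ennreal (P x y) * indicator A y \<partial>leb_on D) \<in> borel_measurable (leb_on D)"
        by measurable
      also have "?this \<longleftrightarrow> (\<lambda>x. emeasure (transition_kernel D P x) A) \<in> borel_measurable (leb_on D)"
        by (intro measurable_cong)
           (simp add: transition_kernel_def emeasure_density sec A space_restrict_space)
      finally show "(\<lambda>x. emeasure (transition_kernel D P x) A) \<in> borel_measurable (leb_on D)" .
    qed (auto simp: transition_kernel_def space_restrict_space
          intro!: prob_space_imp_subprob_space prob[unfolded transition_kernel_def])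
  qed (simp add: prob space_restrict_space)
qed

lemma emeasure_transition_op:
  assumes "D \<in> sets borel" "transition_density D P"
    and "prob_space \<mu>" "sets \<mu> = sets (leb_on D)" "A \<in> sets (leb_on D)"
  shows "emeasure (transition_op D P \<mu>) A = (\<integral>\<^sup>+x. emeasure (transition_kernel D P x) A \<partial>\<mu>)"
  unfolding transition_op_def
  by (rule emeasure_bind_prob_algebra[OF _ measurable_transition_kernel])
     (use assms in \<open>auto simp: space_prob_algebra\<close>)

lemma n_step_in_prob_algebra:
  assumes "D \<in> sets borel" "transition_density D P" "x \<in> D"
  shows "n_step D P n x \<in> space (prob_algebra (leb_on D))"
proof (induction n)
  case 0
  show ?case
    using assms(3) by (simp add: n_step_def space_prob_algebra prob_space_return space_restrict_space)
next
  case (Suc n)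
  show ?case
    using prob_space_bind'[OF Suc measurable_transition_kernel[OF assms(1,2)]]
      sets_bind'[OF Suc measurable_transition_kernel[OF assms(1,2)]]
    by (simp add: n_step_def transition_op_def space_prob_algebra)
qed

lemma emeasure_n_step_Suc:
  assumes "D \<in> sets borel" "transition_density D P" "x \<in> D" "A \<in> sets (leb_on D)"
  shows "emeasure (n_step D P (Suc n) x) A =
    (\<integral>\<^sup>+z. emeasure (transition_kernel D P z) A \<partial>n_step D P n x)"
  using emeasure_transition_op[OF assms(1,2) _ _ assms(4), of "n_step D P n x"]
    n_step_in_prob_algebra[OF assms(1-3), of n]
  by (simp add: n_step_def space_prob_algebra)

end

theory Submission
  imports Defs
begin

text \<open>
  The invariant densities solve \<open>\<pi> = T \<pi>\<close> and \<open>\<eta> = S \<eta>\<close>, so their difference \<open>w = \<pi> - \<eta>\<close> satisfies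
  \<open>(I - T) w = (T - S) \<eta>\<close>, and \<open>w\<close> has mean zero. The theorem therefore rests on one a priori
  estimate that involves \<open>P\<close> alone: a constant \<open>C\<close> with \<open>\<parallel>f\<parallel>\<^sub>2 \<le> C \<parallel>f - T f\<parallel>\<^sub>2\<close> for all mean-zero \<open>f\<close>
  in \<open>L\<^sup>2(D)\<close> (\<open>id_minus_kernel_op_bounded_below\<close>). Since
  \<open>P \<in> L\<^sup>p(D \<times> D) \<subseteq> L\<^sup>2(D \<times> D)\<close>, the operator \<open>T\<close> is Hilbert-Schmidt, hence compact on \<open>L\<^sup>2(D)\<close>,
  and for a compact perturbation of the identity such an estimate follows from injectivity.

  Compactness enters through its concrete source. A kernel in \<open>L\<^sup>2(D \<times> D)\<close> lies within distance
  \<open>1/2\<close> of a finite sum of products \<open>a x * b y\<close> (\<open>separable_kernel_if_sq_integrable\<close>). If the estimate failed,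
  there would be mean-zero \<open>f\<^sub>n\<close> of norm one with \<open>f\<^sub>n - T f\<^sub>n \<longlonglongrightarrow> 0\<close>. Along a subsequence the finitely
  many coefficients of the finite-rank part converge, the remainder contributes at most half of
  \<open>\<parallel>f\<^sub>m - f\<^sub>n\<parallel>\<^sub>2\<close>, and so the subsequence is Cauchy; its limit is a nonzero mean-zero fixed point of \<open>T\<close>.

  Such a fixed point \<open>g\<close> contradicts uniqueness of the invariant measure
  (\<open>unique_invariant_imp_no_mean_zero_fixed_point\<close>). Indeed \<open>\<bar>g\<bar> \<le> T \<bar>g\<bar>\<close>, and \<open>T\<close> preserves the integral of
  nonnegative functions, so \<open>\<bar>g\<bar>\<close> is a fixed point too. Both \<open>\<bar>g\<bar>\<close> and \<open>\<bar>g\<bar> + g\<close> are then nonnegative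
  fixed points with the same integral, so both equal the same multiple of \<open>\<pi>\<close>, and \<open>g = 0\<close>.

  Given the estimate, \<open>\<parallel>w\<parallel>\<^sub>2 \<le> C \<parallel>P - Q\<parallel>\<^sub>2 \<parallel>\<eta>\<parallel>\<^sub>2\<close>. If \<open>C \<parallel>P - Q\<parallel>\<^sub>2 \<le> 1/2\<close>, then
  \<open>\<parallel>\<eta>\<parallel>\<^sub>2 \<le> \<parallel>\<pi>\<parallel>\<^sub>2 + \<parallel>w\<parallel>\<^sub>2\<close> gives \<open>\<parallel>\<eta>\<parallel>\<^sub>2 \<le> 2 \<parallel>\<pi>\<parallel>\<^sub>2\<close>, which removes \<open>Q\<close> from the constant and yields
  the case \<open>p = 2\<close>. For general \<open>p\<close> the identity \<open>w = T w + (T - S) \<eta>\<close> improves integrability: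
  by Cauchy-Schwarz \<open>\<bar>w y\<bar> \<le> \<parallel>P(\<sqdot>, y)\<parallel>\<^sub>2 \<parallel>w\<parallel>\<^sub>2 + \<parallel>(P - Q)(\<sqdot>, y)\<parallel>\<^sub>2 \<parallel>\<eta>\<parallel>\<^sub>2\<close>, and on a set of finite measure
  the \<open>L\<^sup>p\<close> norm of \<open>y \<mapsto> \<parallel>k(\<sqdot>, y)\<parallel>\<^sub>2\<close> is at most a constant times \<open>\<parallel>k\<parallel>\<^sub>p\<close> (\<open>Lp_norm_column_norm_le\<close>).
\<close>

section \<open>Square-integrable functions\<close>

text \<open>
  Functions are not identified almost everywhere. The value of \<open>norm2\<close> below is meaningful only for
  functions satisfying \<open>sq_integrable\<close>: the Bochner integral of a non-integrable function is \<open>0\<close>.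
\<close>
definition sq_integrable :: "'b measure \<Rightarrow> ('b \<Rightarrow> real) \<Rightarrow> bool" where
  "sq_integrable M f \<longleftrightarrow> f \<in> borel_measurable M \<and> integrable M (\<lambda>x. (f x)\<^sup>2)"

definition norm2 :: "'b measure \<Rightarrow> ('b \<Rightarrow> real) \<Rightarrow> real" where
  "norm2 M f = sqrt (\<integral>x. (f x)\<^sup>2 \<partial>M)"

lemma sq_integrable_measurable[measurable_dest]: "sq_integrable M f \<Longrightarrow> f \<in> borel_measurable M"
  by (simp add: sq_integrable_def)

lemma norm2_nonneg[simp]: "0 \<le> norm2 M f"
  by (simp add: norm2_def)

lemma norm2_power2: "(norm2 M f)\<^sup>2 = (\<integral>x. (f x)\<^sup>2 \<partial>M)"
  by (simp add: norm2_def)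

lemma norm2_cong:
  assumes "\<And>x. x \<in> space M \<Longrightarrow> f x = g x"
  shows "norm2 M f = norm2 M g"
  unfolding norm2_def using assms by (metis (no_types, lifting) Bochner_Integration.integral_cong)

lemma norm2_cong_AE:
  assumes "AE x in M. f x = g x" "f \<in> borel_measurable M" "g \<in> borel_measurable M"
  shows "norm2 M f = norm2 M g"
proof -
  have "(\<integral>x. (f x)\<^sup>2 \<partial>M) = (\<integral>x. (g x)\<^sup>2 \<partial>M)"
    using assms by (intro integral_cong_AE) auto
  then show ?thesis by (simp add: norm2_def)
qed

lemma sq_integrable_cong:
  assumes "\<And>x. x \<in> space M \<Longrightarrow> f x = g x"
  shows "sq_integrable M f \<longleftrightarrow> sq_integrable M g"
  unfolding sq_integrable_def
  using assms by (intro conj_cong measurable_cong Bochner_Integration.integrable_cong) auto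

lemma nn_integral_square:
  assumes "sq_integrable M f"
  shows "(\<integral>\<^sup>+x. ennreal ((f x)\<^sup>2) \<partial>M) = ennreal ((norm2 M f)\<^sup>2)"
  unfolding norm2_power2 using assms
  by (subst nn_integral_eq_integral[symmetric]) (auto simp: sq_integrable_def)

lemma sq_integrable_AE_mono:
  assumes "f \<in> borel_measurable M" "sq_integrable M g" "AE x in M. \<bar>f x\<bar> \<le> \<bar>g x\<bar>"
  shows "sq_integrable M f" "norm2 M f \<le> norm2 M g"
proof -
  have le: "AE x in M. (f x)\<^sup>2 \<le> (g x)\<^sup>2"
    using assms(3) by eventually_elim (simp add: abs_le_square_iff)
  show sq: "sq_integrable M f"
    unfolding sq_integrable_def
  proof
    show "integrable M (\<lambda>x. (f x)\<^sup>2)"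
      by (rule Bochner_Integration.integrable_bound[of M "\<lambda>x. (g x)\<^sup>2"])
         (use assms le in \<open>auto simp: sq_integrable_def\<close>)
  qed fact
  show "norm2 M f \<le> norm2 M g"
    unfolding norm2_def using sq assms(2) le
    by (intro real_sqrt_le_mono integral_mono_AE) (auto simp: sq_integrable_def)
qed

lemma sq_integrable_mult:
  assumes "sq_integrable M f" "sq_integrable M g"
  shows "integrable M (\<lambda>x. f x * g x)"
proof (rule Bochner_Integration.integrable_bound[of M "\<lambda>x. (f x)\<^sup>2 + (g x)\<^sup>2"])
  show "AE x in M. norm (f x * g x) \<le> norm ((f x)\<^sup>2 + (g x)\<^sup>2)"
  proof (rule AE_I2)
    fix x
    have "0 \<le> (\<bar>f x\<bar> - \<bar>g x\<bar>)\<^sup>2 + \<bar>f x\<bar> * \<bar>g x\<bar>" "0 \<le> \<bar>f x\<bar> * \<bar>g x\<bar>"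
      by auto
    then show "norm (f x * g x) \<le> norm ((f x)\<^sup>2 + (g x)\<^sup>2)"
      by (simp add: power2_diff abs_mult)
  qed
qed (use assms in \<open>auto simp: sq_integrable_def\<close>)

lemma Cauchy_Schwarz_abs:
  assumes "sq_integrable M f" "sq_integrable M g"
  shows "(\<integral>x. \<bar>f x * g x\<bar> \<partial>M) \<le> norm2 M f * norm2 M g"
proof -
  have [measurable]: "f \<in> borel_measurable M" "g \<in> borel_measurable M"
    using assms by (auto simp: sq_integrable_def)
  let ?I = "\<integral>x. \<bar>f x * g x\<bar> \<partial>M"
  have eq: "(\<integral>\<^sup>+x. ennreal \<bar>f x\<bar> * ennreal \<bar>g x\<bar> \<partial>M) = ennreal ?I"
    using integrable_abs[OF sq_integrable_mult[OF assms]]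
    by (subst nn_integral_eq_integral[symmetric]) (auto simp: ennreal_mult abs_mult)
  have "ennreal (?I\<^sup>2) \<le> ennreal ((norm2 M f)\<^sup>2 * (norm2 M g)\<^sup>2)"
    using Cauchy_Schwarz_nn_integral[of "\<lambda>x. ennreal \<bar>f x\<bar>" M "\<lambda>x. ennreal \<bar>g x\<bar>"]
    by (simp add: eq nn_integral_square assms ennreal_mult ennreal_power integral_nonneg_AE)
  then have "?I\<^sup>2 \<le> (norm2 M f * norm2 M g)\<^sup>2"
    by (simp add: power_mult_distrib)
  then show ?thesis
    by (rule power2_le_imp_le) simp
qed

lemma Cauchy_Schwarz_integral:
  assumes "sq_integrable M f" "sq_integrable M g"
  shows "\<bar>\<integral>x. f x * g x \<partial>M\<bar> \<le> norm2 M f * norm2 M g"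
  using Cauchy_Schwarz_abs[OF assms] integral_abs_bound[of M "\<lambda>x. f x * g x"] by linarith

lemma sq_integrable_cmult[simp]:
  assumes "sq_integrable M f"
  shows "sq_integrable M (\<lambda>x. c * f x)"
  using assms by (auto simp: sq_integrable_def power_mult_distrib)

lemma norm2_cmult: "norm2 M (\<lambda>x. c * f x) = \<bar>c\<bar> * norm2 M f"
  by (simp add: norm2_def power_mult_distrib real_sqrt_mult)

lemma sq_integrable_add[simp]:
  assumes "sq_integrable M f" "sq_integrable M g"
  shows "sq_integrable M (\<lambda>x. f x + g x)"
  using assms sq_integrable_mult[OF assms] by (auto simp: sq_integrable_def power2_sum mult.assoc)

lemma sq_integrable_diff[simp]:
  assumes "sq_integrable M f" "sq_integrable M g"
  shows "sq_integrable M (\<lambda>x. f x - g x)"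
  using sq_integrable_add[OF assms(1) sq_integrable_cmult[OF assms(2), of "-1"]] by simp

lemma norm2_triangle:
  assumes "sq_integrable M f" "sq_integrable M g"
  shows "norm2 M (\<lambda>x. f x + g x) \<le> norm2 M f + norm2 M g"
proof -
  have "(norm2 M (\<lambda>x. f x + g x))\<^sup>2 = (norm2 M f)\<^sup>2 + (norm2 M g)\<^sup>2 + 2 * (\<integral>x. f x * g x \<partial>M)"
    using assms sq_integrable_mult[OF assms]
    by (simp add: norm2_power2 power2_sum mult.assoc sq_integrable_def)
  also have "\<dots> \<le> (norm2 M f + norm2 M g)\<^sup>2"
    using Cauchy_Schwarz_integral[OF assms] by (simp add: power2_sum)
  finally show ?thesis
    by (rule power2_le_imp_le) simp
qed

lemma norm2_minus_commute: "norm2 M (\<lambda>x. f x - g x) = norm2 M (\<lambda>x. g x - f x)"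
  by (simp add: norm2_def power2_commute)

lemma norm2_diff_le:
  assumes "sq_integrable M f" "sq_integrable M g"
  shows "norm2 M (\<lambda>x. f x - g x) \<le> norm2 M f + norm2 M g"
  using norm2_triangle[OF assms(1) sq_integrable_cmult[OF assms(2), of "-1"]]
    norm2_cmult[of M "-1" g] by simp

lemma norm2_triangle_diff:
  assumes "sq_integrable M f" "sq_integrable M g"
  shows "norm2 M f \<le> norm2 M g + norm2 M (\<lambda>x. f x - g x)"
  using norm2_triangle[OF assms(2) sq_integrable_diff[OF assms]] by simp

lemma norm2_eq_0_imp_AE:
  assumes "sq_integrable M f" "norm2 M f = 0"
  shows "AE x in M. f x = 0"
proof -
  have "AE x in M. (f x)\<^sup>2 = 0"
    using assms by (subst integral_nonneg_eq_0_iff_AE[symmetric]) (auto simp: sq_integrable_def norm2_def)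
  then show ?thesis by simp
qed

lemma norm2_tendsto_0_dominated:
  assumes "\<And>n. s n \<in> borel_measurable M" "k \<in> borel_measurable M" "sq_integrable M g"
    and "\<And>x. x \<in> space M \<Longrightarrow> (\<lambda>n. s n x) \<longlonglongrightarrow> k x"
    and "\<And>n x. x \<in> space M \<Longrightarrow> \<bar>s n x - k x\<bar> \<le> g x"
  shows "(\<lambda>n. norm2 M (\<lambda>x. s n x - k x)) \<longlonglongrightarrow> 0"
proof -
  have [measurable]: "\<And>n. s n \<in> borel_measurable M" "k \<in> borel_measurable M" "g \<in> borel_measurable M"
    using assms by (auto simp: sq_integrable_def)
  have "(\<lambda>n. \<integral>x. (s n x - k x)\<^sup>2 \<partial>M) \<longlonglongrightarrow> (\<integral>x. 0 \<partial>M)"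
  proof (rule integral_dominated_convergence)
    show "integrable M (\<lambda>x. (g x)\<^sup>2)" using assms(3) by (simp add: sq_integrable_def)
    have "(\<lambda>n. (s n x - k x)\<^sup>2) \<longlonglongrightarrow> 0" if "x \<in> space M" for x
      using tendsto_power[OF tendsto_diff[OF assms(4)[OF that] tendsto_const[of "k x"]], of 2] by simp
    then show "AE x in M. (\<lambda>n. (s n x - k x)\<^sup>2) \<longlonglongrightarrow> 0" by simp
    show "AE x in M. norm ((s n x - k x)\<^sup>2) \<le> (g x)\<^sup>2" for n
      using assms(5) by (intro AE_I2) (metis norm_power power_mono real_norm_def abs_ge_zero)
  qed auto
  from tendsto_real_sqrt[OF this] show ?thesis
    by (simp add: norm2_def)
qed

lemma (in finite_measure) sq_integrable_bounded:
  assumes "f \<in> borel_measurable M" "\<And>x. x \<in> space M \<Longrightarrow> \<bar>f x\<bar> \<le> B"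
  shows "sq_integrable M f"
  unfolding sq_integrable_def
proof
  show "integrable M (\<lambda>x. (f x)\<^sup>2)"
    using assms power_mono[OF assms(2) abs_ge_zero, where n=2]
    by (intro integrable_const_bound[where B="B\<^sup>2"] AE_I2) auto
qed fact

lemma (in finite_measure) integrable_if_sq_integrable:
  assumes "sq_integrable M f"
  shows "integrable M f"
  using sq_integrable_mult[OF assms sq_integrable_bounded[of "\<lambda>_. 1" 1]] by simp

lemma (in finite_measure) integral_abs_le_norm2:
  assumes "sq_integrable M f"
  shows "(\<integral>x. \<bar>f x\<bar> \<partial>M) \<le> norm2 M f * norm2 M (\<lambda>_. 1)"
  using Cauchy_Schwarz_abs[OF assms sq_integrable_bounded[of "\<lambda>_. 1" 1]] by simp

text \<open>
  Completeness of \<open>L\<^sup>2\<close>. On a finite measure space a Cauchy sequence in mean square is Cauchy in mean,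
  hence has a subsequence that is pointwise Cauchy almost everywhere; its pointwise limit is the
  candidate.
\<close>
lemma (in finite_measure) norm2_Cauchy_imp_convergent:
  assumes sq: "\<And>n. sq_integrable M (f n)"
    and cauchy: "\<And>e. 0 < e \<Longrightarrow> \<exists>N. \<forall>m\<ge>N. \<forall>n\<ge>N. norm2 M (\<lambda>x. f m x - f n x) < e"
  obtains g where "sq_integrable M g" "(\<lambda>n. norm2 M (\<lambda>x. f n x - g x)) \<longlonglongrightarrow> 0"
proof -
  have [measurable]: "\<And>n. f n \<in> borel_measurable M"
    using sq by (auto simp: sq_integrable_def)
  define B where "B = norm2 M (\<lambda>_. 1) + 1"
  have B: "B > 0" by (simp add: B_def add_nonneg_pos)
  have "\<exists>N. \<forall>i\<ge>N. \<forall>j\<ge>N. (\<integral>x. norm (f i x - f j x) \<partial>M) < e" if "e > 0" for e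
  proof -
    obtain N where N: "\<And>i j. i \<ge> N \<Longrightarrow> j \<ge> N \<Longrightarrow> norm2 M (\<lambda>x. f i x - f j x) < e / B"
      using cauchy[OF divide_pos_pos[OF \<open>e > 0\<close> B]] by blast
    have "(\<integral>x. norm (f i x - f j x) \<partial>M) < e" if ij: "i \<ge> N" "j \<ge> N" for i j
    proof -
      have "(\<integral>x. norm (f i x - f j x) \<partial>M) \<le> norm2 M (\<lambda>x. f i x - f j x) * B"
        using integral_abs_le_norm2[OF sq_integrable_diff[OF sq[of i] sq[of j]]]
          norm2_nonneg[of M "\<lambda>x. f i x - f j x"]
        unfolding B_def distrib_left mult_1_right real_norm_def by linarith
      also have "\<dots> < e"
        using N[OF ij] B by (simp add: field_simps)
      finally show ?thesis .
    qed
    then show ?thesis by blast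
  qed
  from cauchy_L1_AE_cauchy_subseq[OF integrable_if_sq_integrable[OF sq] this]
  obtain r where r: "strict_mono r" "AE x in M. Cauchy (\<lambda>i. f (r i) x)" by blast
  define g where "g x = lim (\<lambda>i. f (r i) x)" for x
  have g[measurable]: "g \<in> borel_measurable M"
    unfolding g_def by measurable
  have lim: "AE x in M. (\<lambda>i. f (r i) x) \<longlonglongrightarrow> g x"
    using r(2) by eventually_elim (simp add: g_def Cauchy_convergent_iff convergent_LIMSEQ_iff)
  \<comment> \<open>Fatou's lemma turns the pointwise limit into a limit in mean square.\<close>
  have fatou: "(\<integral>\<^sup>+x. ennreal ((f n x - g x)\<^sup>2) \<partial>M) \<le> ennreal (e\<^sup>2)"
    if e: "\<And>m. m \<ge> N \<Longrightarrow> norm2 M (\<lambda>x. f n x - f m x) \<le> e" for n N e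
  proof -
    have "AE x in M. liminf (\<lambda>i. ennreal ((f n x - f (r i) x)\<^sup>2)) = ennreal ((f n x - g x)\<^sup>2)"
      using lim
    proof eventually_elim
      case (elim x)
      have "(\<lambda>i. ennreal ((f n x - f (r i) x)\<^sup>2)) \<longlonglongrightarrow> ennreal ((f n x - g x)\<^sup>2)"
        by (intro tendsto_intros elim)
      then show ?case by (rule lim_imp_Liminf[rotated]) simp
    qed
    then have "(\<integral>\<^sup>+x. ennreal ((f n x - g x)\<^sup>2) \<partial>M)
        = (\<integral>\<^sup>+x. liminf (\<lambda>i. ennreal ((f n x - f (r i) x)\<^sup>2)) \<partial>M)"
      by (intro nn_integral_cong_AE) auto
    also have "\<dots> \<le> liminf (\<lambda>i. \<integral>\<^sup>+x. ennreal ((f n x - f (r i) x)\<^sup>2) \<partial>M)"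
      by (rule nn_integral_liminf) measurable
    also have "\<dots> \<le> ennreal (e\<^sup>2)"
    proof (rule Liminf_le)
      show "\<forall>\<^sub>F i in sequentially. (\<integral>\<^sup>+x. ennreal ((f n x - f (r i) x)\<^sup>2) \<partial>M) \<le> ennreal (e\<^sup>2)"
        using eventually_ge_at_top[of N]
      proof eventually_elim
        case (elim i)
        have "norm2 M (\<lambda>x. f n x - f (r i) x) \<le> e"
          using e[of "r i"] seq_suble[OF r(1), of i] elim by linarith
        then have "(norm2 M (\<lambda>x. f n x - f (r i) x))\<^sup>2 \<le> e\<^sup>2"
          by (intro power_mono) auto
        then show ?case
          using nn_integral_square[OF sq_integrable_diff[OF sq[of n] sq[of "r i"]]]
          by (simp add: ennreal_power)
      qed
    qed simp
    finally show ?thesis .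
  qed
  have bound: "sq_integrable M (\<lambda>x. f n x - g x) \<and> norm2 M (\<lambda>x. f n x - g x) \<le> e"
    if "\<And>m. m \<ge> N \<Longrightarrow> norm2 M (\<lambda>x. f n x - f m x) \<le> e" for n N e
  proof
    have e: "e \<ge> 0" using that[of N] norm2_nonneg order_trans by blast
    note * = fatou[OF that]
    show sqd: "sq_integrable M (\<lambda>x. f n x - g x)"
      unfolding sq_integrable_def
    proof
      show "integrable M (\<lambda>x. (f n x - g x)\<^sup>2)"
        by (rule integrableI_bounded) (use le_less_trans[OF * ennreal_less_top] in simp_all)
    qed measurable
    have "ennreal ((norm2 M (\<lambda>x. f n x - g x))\<^sup>2) \<le> ennreal (e\<^sup>2)"
      using * nn_integral_square[OF sqd] by (simp add: ennreal_power)
    then show "norm2 M (\<lambda>x. f n x - g x) \<le> e"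
      using e power2_le_imp_le[of "norm2 M (\<lambda>x. f n x - g x)" e] by simp
  qed
  have ev: "\<exists>N. \<forall>n\<ge>N. sq_integrable M (\<lambda>x. f n x - g x) \<and> norm2 M (\<lambda>x. f n x - g x) \<le> e" if "e > 0" for e
  proof -
    obtain N where N: "\<And>m n. m \<ge> N \<Longrightarrow> n \<ge> N \<Longrightarrow> norm2 M (\<lambda>x. f m x - f n x) < e"
      using cauchy[OF \<open>e > 0\<close>] by blast
    have "sq_integrable M (\<lambda>x. f n x - g x) \<and> norm2 M (\<lambda>x. f n x - g x) \<le> e" if "n \<ge> N" for n
      by (rule bound[of N]) (rule less_imp_le, rule N[OF that])
    then show ?thesis by blast
  qed
  show ?thesis
  proof
    obtain N where "sq_integrable M (\<lambda>x. f N x - g x)" using ev[of 1] by auto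
    from sq_integrable_diff[OF sq[of N] this] show "sq_integrable M g" by simp
    show "(\<lambda>n. norm2 M (\<lambda>x. f n x - g x)) \<longlonglongrightarrow> 0"
    proof (rule LIMSEQ_I)
      fix e :: real assume "e > 0"
      with ev[of "e/2"] obtain N where "\<forall>n\<ge>N. norm2 M (\<lambda>x. f n x - g x) \<le> e/2" by auto
      then show "\<exists>N. \<forall>n\<ge>N. norm (norm2 M (\<lambda>x. f n x - g x) - 0) < e"
        using \<open>e > 0\<close> by (intro exI[of _ N]) force
    qed
  qed
qed

section \<open>Separable approximation of square-integrable kernels\<close>

text \<open>
  A kernel of finite rank, represented by the list of its pairs of factors. Lists make sums of such
  kernels a concatenation.
\<close>
definition separated :: "(('b \<Rightarrow> real) \<times> ('c \<Rightarrow> real)) list \<Rightarrow> 'b \<times> 'c \<Rightarrow> real" where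
  "separated ab z = (\<Sum>(a, b)\<leftarrow>ab. a (fst z) * b (snd z))"

definition sq_integrable_factors ::
    "'b measure \<Rightarrow> (('b \<Rightarrow> real) \<times> ('b \<Rightarrow> real)) list \<Rightarrow> bool" where
  "sq_integrable_factors M ab \<longleftrightarrow> (\<forall>(a, b)\<in>set ab. sq_integrable M a \<and> sq_integrable M b)"

definition separable_kernel :: "'b measure \<Rightarrow> ('b \<times> 'b \<Rightarrow> real) \<Rightarrow> bool" where
  "separable_kernel M k \<longleftrightarrow> sq_integrable (M \<Otimes>\<^sub>M M) k \<and>
     (\<forall>e>0. \<exists>ab. sq_integrable_factors M ab \<and> norm2 (M \<Otimes>\<^sub>M M) (\<lambda>z. k z - separated ab z) < e)"

context finite_measure
begin

lemma pair_sigma_finite_self: "pair_sigma_finite M M"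
  by (intro pair_sigma_finite.intro sigma_finite_measure_axioms)

lemma finite_measure_pair_self: "finite_measure (M \<Otimes>\<^sub>M M)"
  by (rule finite_measure_pair_measure) (rule finite_measure_axioms)+

lemma sq_integrable_tensor:
  assumes "sq_integrable M a" "sq_integrable M b"
  shows "sq_integrable (M \<Otimes>\<^sub>M M) (\<lambda>z. a (fst z) * b (snd z))"
    and "norm2 (M \<Otimes>\<^sub>M M) (\<lambda>z. a (fst z) * b (snd z)) = norm2 M a * norm2 M b"
proof -
  have [measurable]: "a \<in> borel_measurable M" "b \<in> borel_measurable M"
    using assms by (auto simp: sq_integrable_def)
  have nn: "(\<integral>\<^sup>+z. ennreal ((a (fst z) * b (snd z))\<^sup>2) \<partial>(M \<Otimes>\<^sub>M M))
      = ennreal ((norm2 M a)\<^sup>2 * (norm2 M b)\<^sup>2)"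
  proof -
    have "(\<integral>\<^sup>+z. ennreal ((a (fst z) * b (snd z))\<^sup>2) \<partial>(M \<Otimes>\<^sub>M M))
        = (\<integral>\<^sup>+x. \<integral>\<^sup>+y. ennreal ((a x)\<^sup>2) * ennreal ((b y)\<^sup>2) \<partial>M \<partial>M)"
      using nn_integral_fst[of "\<lambda>z. ennreal ((a (fst z) * b (snd z))\<^sup>2)" M]
      by (simp add: power_mult_distrib ennreal_mult)
    also have "\<dots> = (\<integral>\<^sup>+x. ennreal ((a x)\<^sup>2) \<partial>M) * (\<integral>\<^sup>+y. ennreal ((b y)\<^sup>2) \<partial>M)"
      by (simp add: nn_integral_cmult nn_integral_multc)
    finally show ?thesis
      using nn_integral_square[OF assms(1)] nn_integral_square[OF assms(2)]
      by (simp add: ennreal_power ennreal_mult)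
  qed
  show *: "sq_integrable (M \<Otimes>\<^sub>M M) (\<lambda>z. a (fst z) * b (snd z))"
    unfolding sq_integrable_def by (intro conjI integrableI_bounded) (simp_all add: nn)
  have "(norm2 (M \<Otimes>\<^sub>M M) (\<lambda>z. a (fst z) * b (snd z)))\<^sup>2 = (norm2 M a * norm2 M b)\<^sup>2"
    using nn nn_integral_square[OF *] by (simp add: ennreal_power power_mult_distrib)
  then show "norm2 (M \<Otimes>\<^sub>M M) (\<lambda>z. a (fst z) * b (snd z)) = norm2 M a * norm2 M b"
    by (simp add: power2_eq_iff_nonneg)
qed

lemma sq_integrable_separated:
  "sq_integrable_factors M ab \<Longrightarrow> sq_integrable (M \<Otimes>\<^sub>M M) (separated ab)"
proof (induction ab)
  case Nil
  then show ?case by (simp add: separated_def sq_integrable_def)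
next
  case (Cons c ab)
  obtain a b where c: "c = (a, b)" by (cases c)
  have eq: "separated (c # ab) = (\<lambda>z. a (fst z) * b (snd z) + separated ab z)"
    by (simp add: separated_def c fun_eq_iff)
  show ?case
    unfolding eq using Cons c
    by (intro sq_integrable_add sq_integrable_tensor) (auto simp: sq_integrable_factors_def)
qed

lemma separated_append: "separated (ab @ ab') z = separated ab z + separated ab' z"
  by (simp add: separated_def)

lemma separated_cmult: "separated (map (\<lambda>(a, b). (\<lambda>x. c * a x, b)) ab) z = c * separated ab z"
  by (induction ab) (auto simp: separated_def algebra_simps)

lemma separable_kernel_cong:
  assumes "\<And>z. z \<in> space (M \<Otimes>\<^sub>M M) \<Longrightarrow> k z = k' z"
  shows "separable_kernel M k \<longleftrightarrow> separable_kernel M k'"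
proof -
  have "norm2 (M \<Otimes>\<^sub>M M) (\<lambda>z. k z - separated ab z) = norm2 (M \<Otimes>\<^sub>M M) (\<lambda>z. k' z - separated ab z)" for ab
    by (rule norm2_cong) (simp add: assms)
  moreover have "sq_integrable (M \<Otimes>\<^sub>M M) k \<longleftrightarrow> sq_integrable (M \<Otimes>\<^sub>M M) k'"
    using assms by (rule sq_integrable_cong)
  ultimately show ?thesis by (simp add: separable_kernel_def)
qed

lemma separable_kernel_tensor:
  assumes "sq_integrable M a" "sq_integrable M b"
  shows "separable_kernel M (\<lambda>z. a (fst z) * b (snd z))"
  unfolding separable_kernel_def
proof (intro conjI allI impI)
  fix e :: real assume "e > 0"
  then show "\<exists>ab. sq_integrable_factors M ab \<and>
      norm2 (M \<Otimes>\<^sub>M M) (\<lambda>z. a (fst z) * b (snd z) - separated ab z) < e"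
    using assms by (intro exI[of _ "[(a, b)]"]) (simp add: sq_integrable_factors_def separated_def norm2_def)
qed (rule sq_integrable_tensor[OF assms])

lemma separable_kernel_add:
  assumes "separable_kernel M k" "separable_kernel M k'"
  shows "separable_kernel M (\<lambda>z. k z + k' z)"
  unfolding separable_kernel_def
proof (intro conjI allI impI)
  have sq: "sq_integrable (M \<Otimes>\<^sub>M M) k" "sq_integrable (M \<Otimes>\<^sub>M M) k'"
    using assms by (auto simp: separable_kernel_def)
  show "sq_integrable (M \<Otimes>\<^sub>M M) (\<lambda>z. k z + k' z)" by (intro sq_integrable_add sq)
  fix e :: real assume "e > 0"
  then have "e/2 > 0" by simp
  obtain ab where ab: "sq_integrable_factors M ab" "norm2 (M \<Otimes>\<^sub>M M) (\<lambda>z. k z - separated ab z) < e/2"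
    using assms(1) \<open>e/2 > 0\<close> unfolding separable_kernel_def by blast
  obtain ab' where ab': "sq_integrable_factors M ab'" "norm2 (M \<Otimes>\<^sub>M M) (\<lambda>z. k' z - separated ab' z) < e/2"
    using assms(2) \<open>e/2 > 0\<close> unfolding separable_kernel_def by blast
  have "norm2 (M \<Otimes>\<^sub>M M) (\<lambda>z. k z + k' z - separated (ab @ ab') z)
      = norm2 (M \<Otimes>\<^sub>M M) (\<lambda>z. (k z - separated ab z) + (k' z - separated ab' z))"
    by (simp only: separated_append add_diff_add)
  also have "\<dots> \<le> norm2 (M \<Otimes>\<^sub>M M) (\<lambda>z. k z - separated ab z) + norm2 (M \<Otimes>\<^sub>M M) (\<lambda>z. k' z - separated ab' z)"
    by (intro norm2_triangle sq_integrable_diff sq sq_integrable_separated ab ab')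
  also have "\<dots> < e" using ab ab' by simp
  finally show "\<exists>ab. sq_integrable_factors M ab \<and>
      norm2 (M \<Otimes>\<^sub>M M) (\<lambda>z. k z + k' z - separated ab z) < e"
    using ab ab' by (intro exI[of _ "ab @ ab'"]) (auto simp: sq_integrable_factors_def)
qed

lemma separable_kernel_cmult:
  assumes "separable_kernel M k"
  shows "separable_kernel M (\<lambda>z. c * k z)"
  unfolding separable_kernel_def
proof (intro conjI allI impI)
  show "sq_integrable (M \<Otimes>\<^sub>M M) (\<lambda>z. c * k z)"
    using assms by (auto simp: separable_kernel_def)
  fix e :: real assume "e > 0"
  then have "e / (\<bar>c\<bar> + 1) > 0" by simp
  then obtain ab where ab: "sq_integrable_factors M ab"
      "norm2 (M \<Otimes>\<^sub>M M) (\<lambda>z. k z - separated ab z) < e / (\<bar>c\<bar> + 1)"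
    using assms unfolding separable_kernel_def by blast
  let ?ab = "map (\<lambda>(a, b). (\<lambda>x. c * a x, b)) ab"
  have "norm2 (M \<Otimes>\<^sub>M M) (\<lambda>z. c * k z - separated ?ab z)
      = norm2 (M \<Otimes>\<^sub>M M) (\<lambda>z. c * (k z - separated ab z))"
    by (simp only: separated_cmult right_diff_distrib)
  also have "\<dots> = \<bar>c\<bar> * norm2 (M \<Otimes>\<^sub>M M) (\<lambda>z. k z - separated ab z)" by (rule norm2_cmult)
  also have "\<dots> \<le> (\<bar>c\<bar> + 1) * norm2 (M \<Otimes>\<^sub>M M) (\<lambda>z. k z - separated ab z)"
    by (intro mult_right_mono) auto
  also have "\<dots> < e" using ab(2) by (simp add: field_simps)
  finally show "\<exists>ab. sq_integrable_factors M ab \<and>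
      norm2 (M \<Otimes>\<^sub>M M) (\<lambda>z. c * k z - separated ab z) < e"
    using ab(1) by (intro exI[of _ ?ab]) (auto simp: sq_integrable_factors_def)
qed

lemma separable_kernel_sum:
  assumes "finite I" "\<And>i. i \<in> I \<Longrightarrow> separable_kernel M (k i)"
  shows "separable_kernel M (\<lambda>z. \<Sum>i\<in>I. k i z)"
  using assms
proof (induction I rule: finite_induct)
  case empty
  show ?case
    using separable_kernel_tensor[of "\<lambda>_. 0" "\<lambda>_. 0"] by (simp add: sq_integrable_def)
qed (simp add: separable_kernel_add)

text \<open>
  Kernels approximable by finite rank form a closed subspace; together with sums and multiples this
  is what the passage from rectangles to all sets and then to all functions uses.
\<close>
lemma separable_kernel_limit:
  assumes "\<And>n. separable_kernel M (s n)" "sq_integrable (M \<Otimes>\<^sub>M M) k"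
    and "(\<lambda>n. norm2 (M \<Otimes>\<^sub>M M) (\<lambda>z. s n z - k z)) \<longlonglongrightarrow> 0"
  shows "separable_kernel M k"
  unfolding separable_kernel_def
proof (intro conjI allI impI)
  have sq: "sq_integrable (M \<Otimes>\<^sub>M M) (s n)" for n
    using assms(1)[of n] by (simp add: separable_kernel_def)
  fix e :: real assume "e > 0"
  then have "e/2 > 0" by simp
  from order_tendstoD(2)[OF assms(3) this]
  obtain n where n: "norm2 (M \<Otimes>\<^sub>M M) (\<lambda>z. s n z - k z) < e/2"
    by (auto simp: eventually_sequentially)
  obtain ab where ab: "sq_integrable_factors M ab" "norm2 (M \<Otimes>\<^sub>M M) (\<lambda>z. s n z - separated ab z) < e/2"
    using assms(1)[of n] \<open>e/2 > 0\<close> unfolding separable_kernel_def by blast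
  have "norm2 (M \<Otimes>\<^sub>M M) (\<lambda>z. k z - separated ab z)
      = norm2 (M \<Otimes>\<^sub>M M) (\<lambda>z. (k z - s n z) + (s n z - separated ab z))" by simp
  also have "\<dots> \<le> norm2 (M \<Otimes>\<^sub>M M) (\<lambda>z. k z - s n z) + norm2 (M \<Otimes>\<^sub>M M) (\<lambda>z. s n z - separated ab z)"
    by (intro norm2_triangle sq_integrable_diff sq assms(2) sq_integrable_separated ab)
  also have "\<dots> < e" using ab n norm2_minus_commute[of "M \<Otimes>\<^sub>M M" k "s n"] by simp
  finally show "\<exists>ab. sq_integrable_factors M ab \<and> norm2 (M \<Otimes>\<^sub>M M) (\<lambda>z. k z - separated ab z) < e"
    using ab(1) by blast
qed fact

lemma separable_kernel_dominated_limit: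
  assumes "\<And>n. separable_kernel M (s n)" "sq_integrable (M \<Otimes>\<^sub>M M) k" "sq_integrable (M \<Otimes>\<^sub>M M) g"
    and "\<And>z. z \<in> space (M \<Otimes>\<^sub>M M) \<Longrightarrow> (\<lambda>n. s n z) \<longlonglongrightarrow> k z"
    and "\<And>n z. z \<in> space (M \<Otimes>\<^sub>M M) \<Longrightarrow> \<bar>s n z - k z\<bar> \<le> g z"
  shows "separable_kernel M k"
proof (rule separable_kernel_limit)
  show "(\<lambda>n. norm2 (M \<Otimes>\<^sub>M M) (\<lambda>z. s n z - k z)) \<longlonglongrightarrow> 0"
    using assms(1,2) by (intro norm2_tendsto_0_dominated[OF _ _ assms(3-5)])
      (simp_all add: separable_kernel_def sq_integrable_def)
qed (fact assms)+

text \<open>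
  Rectangles have rank one and generate the product sigma-algebra, so a Dynkin argument suffices.
  Disjoint unions are limits of their finite partial unions, dominated by \<open>1\<close> because the measure is finite.
\<close>
lemma separable_kernel_indicator:
  assumes "A \<in> sets (M \<Otimes>\<^sub>M M)"
  shows "separable_kernel M (indicator A)"
proof -
  interpret MM: finite_measure "M \<Otimes>\<^sub>M M" by (rule finite_measure_pair_self)
  have rect: "separable_kernel M (indicator (a \<times> b))" if [measurable]: "a \<in> sets M" "b \<in> sets M" for a b
  proof -
    have "separable_kernel M (\<lambda>z. indicator a (fst z) * indicator b (snd z))"
      by (intro separable_kernel_tensor sq_integrable_bounded[where B=1]) auto
    moreover have "(\<lambda>z. indicator a (fst z) * indicator b (snd z)) = (indicator (a \<times> b) :: _ \<Rightarrow> real)"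
      by (rule ext) (simp add: indicator_times)
    ultimately show ?thesis by (simp only:)
  qed
  have ind: "sq_integrable (M \<Otimes>\<^sub>M M) (indicator A)" if "A \<in> sets (M \<Otimes>\<^sub>M M)" for A
    using that by (intro MM.sq_integrable_bounded[where B=1]) auto
  show ?thesis
    using Int_stable_pair_measure_generator pair_measure_closed assms
    unfolding sets_pair_measure
  proof (induction rule: sigma_sets_induct_disjoint)
    case (basic A)
    then show ?case using rect by auto
  next
    case empty
    from rect[of "{}" "{}"] show ?case unfolding Sigma_empty1 by blast
  next
    case (compl A)
    have "separable_kernel M (\<lambda>z. indicator (space M \<times> space M) z + (-1) * indicator A z)"
      by (intro separable_kernel_add separable_kernel_cmult rect compl) auto
    then show ?case
      by (rule separable_kernel_cong[THEN iffD1, rotated]) (auto simp: space_pair_measure split: split_indicator)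
  next
    case (union A)
    have A: "A i \<in> sets (M \<Otimes>\<^sub>M M)" for i
      using union(2) by (auto simp: sets_pair_measure)
    have "separable_kernel M (indicator (\<Union>i<n. A i))" for n
    proof -
      have "separable_kernel M (\<lambda>z. \<Sum>i<n. indicator (A i) z)"
        by (intro separable_kernel_sum union) auto
      moreover have "(\<lambda>z. \<Sum>i<n. indicator (A i) z :: real) = indicator (\<Union>i<n. A i)"
        using union(1)
        by (intro ext indicator_UN_disjoint[symmetric]) (auto simp: disjoint_family_on_def)
      ultimately show ?thesis by (simp only:)
    qed
    moreover have "sq_integrable (M \<Otimes>\<^sub>M M) (indicator (\<Union>i. A i))"
      using A by (intro ind) auto
    moreover have "sq_integrable (M \<Otimes>\<^sub>M M) (\<lambda>_. 1)"
      by (rule MM.sq_integrable_bounded[where B=1]) auto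
    ultimately show ?case
      by (rule separable_kernel_dominated_limit) (rule LIMSEQ_indicator_UN, simp split: split_indicator)
  qed
qed

text \<open>
  Simple functions are finite combinations of indicators, and every measurable \<open>k\<close> is a pointwise
  limit of simple functions bounded by \<open>2 * \<bar>k\<bar>\<close>; the differences are then dominated by \<open>3 * \<bar>k\<bar>\<close>.
\<close>
lemma separable_kernel_if_sq_integrable:
  assumes "sq_integrable (M \<Otimes>\<^sub>M M) k"
  shows "separable_kernel M k"
proof -
  have simple: "separable_kernel M f" if f: "simple_function (M \<Otimes>\<^sub>M M) f" for f :: "'a \<times> 'a \<Rightarrow> real"
  proof -
    let ?S = "space (M \<Otimes>\<^sub>M M)"
    have fin: "finite (f ` ?S)" using f by (simp add: simple_function_def)
    have "separable_kernel M (\<lambda>z. \<Sum>v\<in>f ` ?S. v * indicator (f -` {v} \<inter> ?S) z)"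
      using fin f
      by (intro separable_kernel_sum separable_kernel_cmult separable_kernel_indicator)
         (auto simp: simple_function_def)
    then show ?thesis
    proof (rule separable_kernel_cong[THEN iffD1, rotated])
      fix z assume z: "z \<in> ?S"
      have "(\<Sum>v\<in>f ` ?S. v * indicator (f -` {v} \<inter> ?S) z) = (\<Sum>v\<in>f ` ?S. if f z = v then v else 0)"
        using z by (intro sum.cong) (auto split: split_indicator)
      also have "\<dots> = f z" using z fin by (simp add: sum.delta')
      finally show "(\<Sum>v\<in>f ` ?S. v * indicator (f -` {v} \<inter> ?S) z) = f z" .
    qed
  qed
  have "k \<in> borel_measurable (M \<Otimes>\<^sub>M M)" using assms by (simp add: sq_integrable_def)
  from borel_measurable_implies_sequence_metric[OF this, of 0]
  obtain F where F: "\<And>i. simple_function (M \<Otimes>\<^sub>M M) (F i)"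
      "\<And>z. z \<in> space (M \<Otimes>\<^sub>M M) \<Longrightarrow> (\<lambda>i. F i z) \<longlonglongrightarrow> k z"
      "\<And>i z. z \<in> space (M \<Otimes>\<^sub>M M) \<Longrightarrow> \<bar>F i z\<bar> \<le> 2 * \<bar>k z\<bar>"
    unfolding dist_real_def diff_zero by blast
  show ?thesis
  proof (rule separable_kernel_dominated_limit[of F])
    show "sq_integrable (M \<Otimes>\<^sub>M M) (\<lambda>z. 3 * \<bar>k z\<bar>)"
      using assms by (auto simp: sq_integrable_def power_mult_distrib)
    show "\<bar>F n z - k z\<bar> \<le> 3 * \<bar>k z\<bar>" if "z \<in> space (M \<Otimes>\<^sub>M M)" for n z
      using F(3)[OF that, of n] by linarith
  qed (use F assms simple in auto)
qed

end

section \<open>Hilbert-Schmidt operators\<close>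

text \<open>
  The first variable is integrated out: for a transition density \<open>k\<close> this is the action of the chain
  on densities, not on observables.
\<close>
definition kernel_op :: "'b measure \<Rightarrow> ('b \<times> 'b \<Rightarrow> real) \<Rightarrow> ('b \<Rightarrow> real) \<Rightarrow> 'b \<Rightarrow> real" where
  "kernel_op M k f y = (\<integral>x. k (x, y) * f x \<partial>M)"

text \<open>
  For a square-integrable kernel this is the \<open>L\<^sup>2\<close> norm of the section at \<open>y\<close> for almost every \<open>y\<close>;
  on the remaining null set it has the default value \<open>0\<close>.
\<close>
definition column_norm :: "'b measure \<Rightarrow> ('b \<times> 'b \<Rightarrow> real) \<Rightarrow> 'b \<Rightarrow> real" where
  "column_norm M k y = norm2 M (\<lambda>x. k (x, y))"

lemma column_norm_nonneg[simp]: "0 \<le> column_norm M k y"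
  by (simp add: column_norm_def)

text \<open>
  Bolzano-Weierstrass in finite dimension, with the coordinates indexed by an arbitrary finite set.
\<close>
lemma common_convergent_subsequence:
  fixes c :: "'i \<Rightarrow> nat \<Rightarrow> real"
  assumes "finite I" "\<And>i. i \<in> I \<Longrightarrow> bounded (range (c i))"
  shows "\<exists>r. strict_mono r \<and> (\<forall>i\<in>I. convergent (\<lambda>n. c i (r n)))"
  using assms
proof (induction I rule: finite_induct)
  case empty
  show ?case using strict_mono_id by blast
next
  case (insert i I)
  then obtain r :: "nat \<Rightarrow> nat" where r: "strict_mono r" "\<forall>i\<in>I. convergent (\<lambda>n. c i (r n))" by auto
  have "bounded (range (c i))" using insert by simp
  then have "bounded (range (\<lambda>n. c i (r n)))" by (rule bounded_subset) auto
  then obtain l s where s: "strict_mono s" "((\<lambda>n. c i (r n)) \<circ> s) \<longlonglongrightarrow> l"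
    using bounded_imp_convergent_subsequence by blast
  have "convergent (\<lambda>n. c j (r (s n)))" if "j \<in> insert i I" for j
  proof (cases "j = i")
    case True
    then show ?thesis using s(2) by (auto simp: convergent_def o_def)
  next
    case False
    then have "convergent (\<lambda>n. c j (r n))" using r(2) that by simp
    from convergent_subseq_convergent[OF this s(1)] show ?thesis by (simp add: o_def)
  qed
  then show ?case
    using strict_mono_o[OF r(1) s(1)] by (intro exI[of _ "r \<circ> s"] conjI) (simp_all only: o_def, blast)
qed

context finite_measure
begin

lemma AE_sq_integrable_column:
  assumes "sq_integrable (M \<Otimes>\<^sub>M M) k"
  shows "AE y in M. sq_integrable M (\<lambda>x. k (x, y))"
proof -
  interpret P: pair_sigma_finite M M by (rule pair_sigma_finite_self)
  have [measurable]: "k \<in> borel_measurable (M \<Otimes>\<^sub>M M)" using assms by (simp add: sq_integrable_def)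
  have "integrable (M \<Otimes>\<^sub>M M) (case_prod (\<lambda>x y. (k (x, y))\<^sup>2))"
    using assms by (simp add: sq_integrable_def case_prod_beta')
  from P.AE_integrable_snd[OF this] AE_space show ?thesis
    by eventually_elim (auto simp: sq_integrable_def)
qed

lemma column_norm_sq_integrable:
  assumes "sq_integrable (M \<Otimes>\<^sub>M M) k"
  shows "sq_integrable M (column_norm M k)"
    and "norm2 M (column_norm M k) = norm2 (M \<Otimes>\<^sub>M M) k"
proof -
  interpret P: pair_sigma_finite M M by (rule pair_sigma_finite_self)
  have [measurable]: "k \<in> borel_measurable (M \<Otimes>\<^sub>M M)" using assms by (simp add: sq_integrable_def)
  have int: "integrable (M \<Otimes>\<^sub>M M) (case_prod (\<lambda>x y. (k (x, y))\<^sup>2))"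
    using assms by (simp add: sq_integrable_def case_prod_beta')
  show "sq_integrable M (column_norm M k)"
    using P.integrable_snd[OF int] unfolding sq_integrable_def column_norm_def norm2_power2
    by (simp add: norm2_def)
  show "norm2 M (column_norm M k) = norm2 (M \<Otimes>\<^sub>M M) k"
    using P.integral_snd[OF int]
    by (simp add: norm2_def[of M "column_norm M k"] column_norm_def norm2_power2
        norm2_def[of "M \<Otimes>\<^sub>M M"] case_prod_beta')
qed

lemma kernel_op_measurable[measurable]:
  assumes [measurable]: "k \<in> borel_measurable (M \<Otimes>\<^sub>M M)" "f \<in> borel_measurable M"
  shows "kernel_op M k f \<in> borel_measurable M"
  unfolding kernel_op_def by measurable

text \<open>
  The pointwise Cauchy-Schwarz bound that carries an \<open>L\<^sup>2\<close> estimate of \<open>f\<close> to any norm in which the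
  columns of the kernel are controlled.
\<close>
lemma kernel_op_le_column_norm:
  assumes "sq_integrable (M \<Otimes>\<^sub>M M) k" "sq_integrable M f"
  shows "AE y in M. \<bar>kernel_op M k f y\<bar> \<le> column_norm M k y * norm2 M f"
  using AE_sq_integrable_column[OF assms(1)]
  by eventually_elim (simp add: kernel_op_def column_norm_def Cauchy_Schwarz_integral assms)

lemma kernel_op_sq_integrable:
  assumes "sq_integrable (M \<Otimes>\<^sub>M M) k" "sq_integrable M f"
  shows "sq_integrable M (kernel_op M k f)"
    and "norm2 M (kernel_op M k f) \<le> norm2 (M \<Otimes>\<^sub>M M) k * norm2 M f"
proof -
  have m: "kernel_op M k f \<in> borel_measurable M"
    using assms by (intro kernel_op_measurable) (auto simp: sq_integrable_def)
  have sq: "sq_integrable M (\<lambda>y. norm2 M f * column_norm M k y)"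
    by (intro sq_integrable_cmult column_norm_sq_integrable assms)
  have le: "AE y in M. \<bar>kernel_op M k f y\<bar> \<le> \<bar>norm2 M f * column_norm M k y\<bar>"
    using kernel_op_le_column_norm[OF assms] by eventually_elim (simp add: mult.commute)
  show "sq_integrable M (kernel_op M k f)"
    by (rule sq_integrable_AE_mono[OF m sq le])
  show "norm2 M (kernel_op M k f) \<le> norm2 (M \<Otimes>\<^sub>M M) k * norm2 M f"
    using sq_integrable_AE_mono(2)[OF m sq le]
    by (simp add: norm2_cmult column_norm_sq_integrable assms mult.commute)
qed

lemma kernel_op_diff_right:
  assumes "sq_integrable (M \<Otimes>\<^sub>M M) k" "sq_integrable M f" "sq_integrable M g"
  shows "AE y in M. kernel_op M k (\<lambda>x. f x - g x) y = kernel_op M k f y - kernel_op M k g y"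
  using AE_sq_integrable_column[OF assms(1)]
  by eventually_elim (simp add: kernel_op_def right_diff_distrib sq_integrable_mult assms)

lemma kernel_op_diff_left:
  assumes "sq_integrable (M \<Otimes>\<^sub>M M) k" "sq_integrable (M \<Otimes>\<^sub>M M) l" "sq_integrable M f"
  shows "AE y in M. kernel_op M (\<lambda>z. k z - l z) f y = kernel_op M k f y - kernel_op M l f y"
  using AE_sq_integrable_column[OF assms(1)] AE_sq_integrable_column[OF assms(2)]
  by eventually_elim (simp add: kernel_op_def left_diff_distrib sq_integrable_mult assms)

text \<open>
  A finite-rank operator sees \<open>f\<close> only through its coefficients against the left factors, which turns
  convergence of finitely many scalars into convergence in norm.
\<close>
lemma kernel_op_separated:
  assumes "sq_integrable_factors M ab" "sq_integrable M f"
  shows "norm2 M (kernel_op M (separated ab) f) \<le> (\<Sum>(a, b)\<leftarrow>ab. \<bar>\<integral>x. a x * f x \<partial>M\<bar> * norm2 M b)"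
  using assms(1)
proof (induction ab)
  case Nil
  then show ?case by (simp add: separated_def kernel_op_def norm2_def)
next
  case (Cons c ab)
  obtain a b where c: "c = (a, b)" by (cases c)
  have sq: "sq_integrable M a" "sq_integrable M b" "sq_integrable_factors M ab"
    using Cons.prems by (auto simp: c sq_integrable_factors_def)
  have int: "integrable M (\<lambda>x. separated ab (x, y) * f x)" for y
    using sq(3)
  proof (induction ab)
    case Nil
    then show ?case by (simp add: separated_def)
  next
    case (Cons d ab)
    obtain u v where d: "d = (u, v)" by (cases d)
    have "integrable M (\<lambda>x. v y * (u x * f x) + separated ab (x, y) * f x)"
    proof (rule Bochner_Integration.integrable_add)
      show "integrable M (\<lambda>x. v y * (u x * f x))"
        using Cons.prems assms(2)
        by (intro integrable_mult_right sq_integrable_mult) (auto simp: d sq_integrable_factors_def)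
      show "integrable M (\<lambda>x. separated ab (x, y) * f x)"
        using Cons by (simp add: sq_integrable_factors_def)
    qed
    then show ?case by (simp add: d separated_def algebra_simps)
  qed
  have "kernel_op M (separated (c # ab)) f y
      = (\<integral>x. a x * f x \<partial>M) * b y + kernel_op M (separated ab) f y" for y
  proof -
    have "kernel_op M (separated (c # ab)) f y
        = (\<integral>x. b y * (a x * f x) + separated ab (x, y) * f x \<partial>M)"
      by (simp add: kernel_op_def c separated_def algebra_simps)
    also have "\<dots> = b y * (\<integral>x. a x * f x \<partial>M) + kernel_op M (separated ab) f y"
      unfolding kernel_op_def
      by (subst Bochner_Integration.integral_add)
         (use int sq_integrable_mult[OF sq(1) assms(2)] in auto)
    finally show ?thesis by (simp add: mult.commute)
  qed
  then have "norm2 M (kernel_op M (separated (c # ab)) f)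
      = norm2 M (\<lambda>y. (\<integral>x. a x * f x \<partial>M) * b y + kernel_op M (separated ab) f y)"
    by (intro norm2_cong) simp
  also have "\<dots> \<le> norm2 M (\<lambda>y. (\<integral>x. a x * f x \<partial>M) * b y) + norm2 M (kernel_op M (separated ab) f)"
    by (intro norm2_triangle sq_integrable_cmult sq kernel_op_sq_integrable sq_integrable_separated assms)
  also have "\<dots> \<le> (\<Sum>(a, b)\<leftarrow>c # ab. \<bar>\<integral>x. a x * f x \<partial>M\<bar> * norm2 M b)"
    using Cons.IH[OF sq(3)] by (simp add: c norm2_cmult)
  finally show ?case .
qed

text \<open>
  The lower half of the Fredholm alternative on mean-zero functions, proved by contradiction from
  sequential compactness. Only one approximation of the kernel is required, at distance less than \<open>1/2\<close>:
  the identity \<open>d = (I - K) d + R d + F d\<close> with \<open>K = R + F\<close> and \<open>\<parallel>R d\<parallel> \<le> \<parallel>d\<parallel> / 2\<close> lets the remainder be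
  absorbed into the left-hand side.
\<close>
lemma id_minus_kernel_op_bounded_below:
  assumes k: "sq_integrable (M \<Otimes>\<^sub>M M) k"
    and inj: "\<And>g. sq_integrable M g \<Longrightarrow> (\<integral>x. g x \<partial>M) = 0 \<Longrightarrow>
      AE y in M. g y = kernel_op M k g y \<Longrightarrow> AE y in M. g y = 0"
  shows "\<exists>C>0. \<forall>f. sq_integrable M f \<longrightarrow> (\<integral>x. f x \<partial>M) = 0 \<longrightarrow>
      norm2 M f \<le> C * norm2 M (\<lambda>y. f y - kernel_op M k f y)"
proof (rule ccontr)
  let ?D = "\<lambda>f y. f y - kernel_op M k f y"
  assume contr: "\<not> ?thesis"
  have "\<exists>f. sq_integrable M f \<and> (\<integral>x. f x \<partial>M) = 0 \<and> norm2 M f = 1 \<and> norm2 M (?D f) \<le> 1 / real (Suc n)" for n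
  proof -
    obtain f where f: "sq_integrable M f" "(\<integral>x. f x \<partial>M) = 0"
        "norm2 M f > real (Suc n) * norm2 M (?D f)"
    proof -
      have "\<not> (\<forall>f. sq_integrable M f \<longrightarrow> (\<integral>x. f x \<partial>M) = 0 \<longrightarrow>
          norm2 M f \<le> real (Suc n) * norm2 M (?D f))"
        using contr by (metis of_nat_0_less_iff zero_less_Suc)
      then show ?thesis using that by (auto simp: not_le)
    qed
    have pos: "norm2 M f > 0"
      by (rule le_less_trans[OF _ f(3)]) simp
    let ?g = "\<lambda>x. (1 / norm2 M f) * f x"
    have D: "?D ?g = (\<lambda>y. (1 / norm2 M f) * ?D f y)"
      by (simp add: fun_eq_iff kernel_op_def diff_divide_distrib)
    have "norm2 M (?D ?g) \<le> 1 / real (Suc n)"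
      unfolding D norm2_cmult using pos f(3) by (simp add: field_simps del: of_nat_Suc)
    moreover have "norm2 M ?g = 1" unfolding norm2_cmult using pos by simp
    moreover have "sq_integrable M ?g" by (rule sq_integrable_cmult[OF f(1)])
    moreover have "(\<integral>x. ?g x \<partial>M) = 0" using f(2) by simp
    ultimately show ?thesis by blast
  qed
  then obtain f where f: "\<And>n. sq_integrable M (f n)" "\<And>n. (\<integral>x. f n x \<partial>M) = 0"
      "\<And>n. norm2 M (f n) = 1" "\<And>n. norm2 M (?D (f n)) \<le> 1 / real (Suc n)"
    by metis
  have "separable_kernel M k" using k by (rule separable_kernel_if_sq_integrable)
  then obtain ab where ab: "sq_integrable_factors M ab"
      "norm2 (M \<Otimes>\<^sub>M M) (\<lambda>z. k z - separated ab z) < 1/2"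
    unfolding separable_kernel_def by (meson half_gt_zero zero_less_one)
  have sqs: "sq_integrable (M \<Otimes>\<^sub>M M) (separated ab)" by (rule sq_integrable_separated[OF ab(1)])
  have "\<exists>r. strict_mono r \<and> (\<forall>i\<in>set ab. convergent (\<lambda>n. (\<lambda>(a, b) n. \<integral>x. a x * f n x \<partial>M) i (r n)))"
  proof (rule common_convergent_subsequence)
    fix i assume "i \<in> set ab"
    then obtain a b where i: "i = (a, b)" "sq_integrable M a"
      using ab(1) by (auto simp: sq_integrable_factors_def)
    show "bounded (range ((\<lambda>(a, b) n. \<integral>x. a x * f n x \<partial>M) i))"
      unfolding bounded_iff
    proof (intro exI ballI)
      fix v assume "v \<in> range ((\<lambda>(a, b) n. \<integral>x. a x * f n x \<partial>M) i)"
      then show "norm v \<le> norm2 M a"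
        using Cauchy_Schwarz_integral[OF i(2) f(1)] by (auto simp: i f(3))
    qed
  qed simp
  then obtain r :: "nat \<Rightarrow> nat" where r: "strict_mono r"
      "\<And>a b. (a, b) \<in> set ab \<Longrightarrow> convergent (\<lambda>n. \<integral>x. a x * f (r n) x \<partial>M)"
    by fastforce
  define h where "h n = f (r n)" for n
  have h: "sq_integrable M (h n)" "(\<integral>x. h n x \<partial>M) = 0" "norm2 M (h n) = 1" for n
    using f by (auto simp: h_def)
  have Dh: "norm2 M (?D (h n)) \<le> 1 / real (Suc n)" for n
  proof -
    have "norm2 M (?D (h n)) \<le> 1 / real (Suc (r n))" unfolding h_def by (rule f(4))
    also have "\<dots> \<le> 1 / real (Suc n)"
      using seq_suble[OF r(1), of n] by (intro divide_left_mono) auto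
    finally show ?thesis .
  qed
  have meas: "kernel_op M k g \<in> borel_measurable M" if "sq_integrable M g" for g
    using kernel_op_sq_integrable(1)[OF k that] by (simp add: sq_integrable_def)
  let ?F = "\<lambda>m n. \<Sum>(a, b)\<leftarrow>ab. \<bar>\<integral>x. a x * (h m x - h n x) \<partial>M\<bar> * norm2 M b"
  \<comment> \<open>Absorbing the remainder \<open>?R\<close> costs the factor \<open>2\<close>.\<close>
  have diff: "norm2 M (\<lambda>x. h m x - h n x) \<le> 2 * (1 / real (Suc m) + 1 / real (Suc n) + ?F m n)" for m n
  proof -
    let ?d = "\<lambda>x. h m x - h n x"
    have sqd: "sq_integrable M ?d" by (intro sq_integrable_diff h)
    let ?R = "kernel_op M (\<lambda>z. k z - separated ab z) ?d"
    let ?S = "kernel_op M (separated ab) ?d"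
    have sqR: "sq_integrable M ?R"
      by (rule kernel_op_sq_integrable[OF sq_integrable_diff[OF k sqs] sqd])
    have R: "norm2 M ?R \<le> 1/2 * norm2 M ?d"
    proof -
      have "norm2 M ?R \<le> norm2 (M \<Otimes>\<^sub>M M) (\<lambda>z. k z - separated ab z) * norm2 M ?d"
        by (rule kernel_op_sq_integrable[OF sq_integrable_diff[OF k sqs] sqd])
      also have "\<dots> \<le> 1/2 * norm2 M ?d"
        using ab(2) by (intro mult_right_mono) auto
      finally show ?thesis .
    qed
    have sqS: "sq_integrable M ?S" by (rule kernel_op_sq_integrable[OF sqs sqd])
    have sqDh: "sq_integrable M (?D (h n))" for n
      by (intro sq_integrable_diff h kernel_op_sq_integrable k)
    have ae: "AE y in M. ?d y = (?D (h m) y - ?D (h n) y) + (?R y + ?S y)"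
      using kernel_op_diff_right[OF k h(1)[of m] h(1)[of n]] kernel_op_diff_left[OF k sqs sqd]
      by eventually_elim simp
    have "norm2 M ?d = norm2 M (\<lambda>y. (?D (h m) y - ?D (h n) y) + (?R y + ?S y))"
      by (rule norm2_cong_AE[OF ae])
         (intro sq_integrable_measurable sqd sq_integrable_add sq_integrable_diff sqDh sqR sqS)+
    moreover have "\<dots> \<le> norm2 M (\<lambda>y. ?D (h m) y - ?D (h n) y) + norm2 M (\<lambda>y. ?R y + ?S y)"
      by (intro norm2_triangle sq_integrable_add sq_integrable_diff sqDh sqR sqS)
    moreover have "norm2 M (\<lambda>y. ?R y + ?S y) \<le> norm2 M ?R + norm2 M ?S"
      by (rule norm2_triangle[OF sqR sqS])
    moreover have "norm2 M (\<lambda>y. ?D (h m) y - ?D (h n) y) \<le> norm2 M (?D (h m)) + norm2 M (?D (h n))"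
      by (rule norm2_diff_le[OF sqDh sqDh])
    moreover have "norm2 M ?S \<le> ?F m n"
      by (rule kernel_op_separated[OF ab(1) sqd])
    ultimately show ?thesis
      using R Dh[of m] Dh[of n] by argo
  qed
  \<comment> \<open>Three terms, each below \<open>e / 6\<close>, survive the factor \<open>2\<close>.\<close>
  have cauchy: "\<exists>N. \<forall>m\<ge>N. \<forall>n\<ge>N. norm2 M (\<lambda>x. h m x - h n x) < e" if "e > 0" for e
  proof -
    have F: "\<exists>N. \<forall>m\<ge>N. \<forall>n\<ge>N. ?F m n < e / 6"
    proof -
      have "\<exists>N. \<forall>m\<ge>N. \<forall>n\<ge>N. (\<Sum>(a, b)\<leftarrow>l. \<bar>\<integral>x. a x * (h m x - h n x) \<partial>M\<bar> * norm2 M b) < e"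
        if "set l \<subseteq> set ab" "e > 0" for l e
        using that
      proof (induction l arbitrary: e)
        case Nil
        then show ?case by simp
      next
        case (Cons c l)
        obtain a b where c: "c = (a, b)" by (cases c)
        have mem: "(a, b) \<in> set ab" using Cons.prems by (simp add: c)
        then have a: "sq_integrable M a" using ab(1) by (auto simp: sq_integrable_factors_def)
        have "Cauchy (\<lambda>n. \<integral>x. a x * h n x \<partial>M)"
          using r(2)[OF mem] by (simp add: h_def Cauchy_convergent_iff)
        moreover have "e / (2 * (norm2 M b + 1)) > 0"
          using Cons.prems by (simp add: add_nonneg_pos)
        ultimately obtain N1 where N1: "\<And>m n. m \<ge> N1 \<Longrightarrow> n \<ge> N1 \<Longrightarrow>
            \<bar>(\<integral>x. a x * h m x \<partial>M) - (\<integral>x. a x * h n x \<partial>M)\<bar> < e / (2 * (norm2 M b + 1))"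
          unfolding Cauchy_def dist_real_def by blast
        have "e / 2 > 0" "set l \<subseteq> set ab" using Cons.prems by auto
        from Cons.IH[OF this(2,1)] obtain N2 where N2: "\<And>m n. m \<ge> N2 \<Longrightarrow> n \<ge> N2 \<Longrightarrow>
            (\<Sum>(a, b)\<leftarrow>l. \<bar>\<integral>x. a x * (h m x - h n x) \<partial>M\<bar> * norm2 M b) < e / 2" by blast
        show ?case
        proof (intro exI allI impI)
          fix m n assume mn: "m \<ge> max N1 N2" "n \<ge> max N1 N2"
          have eq: "(\<integral>x. a x * (h m x - h n x) \<partial>M) = (\<integral>x. a x * h m x \<partial>M) - (\<integral>x. a x * h n x \<partial>M)"
            unfolding right_diff_distrib
            by (rule Bochner_Integration.integral_diff) (intro sq_integrable_mult a h)+
          have "\<bar>\<integral>x. a x * (h m x - h n x) \<partial>M\<bar> * norm2 M b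
              \<le> e / (2 * (norm2 M b + 1)) * (norm2 M b + 1)"
            unfolding eq using N1[of m n] mn by (intro mult_mono) auto
          also have "\<dots> = e / 2"
          proof -
            have "B + 1 \<noteq> 0 \<Longrightarrow> e / (2 * (B + 1)) * (B + 1) = e / 2" for B :: real
              by (simp add: field_simps)
            moreover have "norm2 M b + 1 \<noteq> 0" using norm2_nonneg[of M b] by linarith
            ultimately show ?thesis by blast
          qed
          finally show "(\<Sum>(a, b)\<leftarrow>c # l. \<bar>\<integral>x. a x * (h m x - h n x) \<partial>M\<bar> * norm2 M b) < e"
            using N2[of m n] mn by (simp add: c)
        qed
      qed
      from this[of ab "e / 6"] show ?thesis using that by simp
    qed
    then obtain N1 where N1: "\<And>m n. m \<ge> N1 \<Longrightarrow> n \<ge> N1 \<Longrightarrow> ?F m n < e / 6" by blast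
    obtain N2 where N2: "1 / real (Suc N2) < e / 6"
      using nat_approx_posE[of "e / 6"] \<open>e > 0\<close> by (metis divide_pos_pos zero_less_numeral)
    have small: "1 / real (Suc n) < e / 6" if "n \<ge> N2" for n
    proof -
      have "1 / real (Suc n) \<le> 1 / real (Suc N2)"
        using that by (intro divide_left_mono) auto
      then show ?thesis using N2 by linarith
    qed
    show ?thesis
    proof (intro exI allI impI)
      fix m n assume "m \<ge> max N1 N2" "n \<ge> max N1 N2"
      then show "norm2 M (\<lambda>x. h m x - h n x) < e"
        using diff[of m n] N1[of m n] small[of m] small[of n] by simp
    qed
  qed
  obtain g where g: "sq_integrable M g" "(\<lambda>n. norm2 M (\<lambda>x. h n x - g x)) \<longlonglongrightarrow> 0"
    using norm2_Cauchy_imp_convergent[OF h(1) cauchy] by blast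
  have sqhg: "sq_integrable M (\<lambda>x. h n x - g x)" for n by (intro sq_integrable_diff h g)
  have mean: "(\<integral>x. g x \<partial>M) = 0"
  proof -
    have "\<bar>\<integral>x. g x \<partial>M\<bar> \<le> norm2 M (\<lambda>x. h n x - g x) * norm2 M (\<lambda>_. 1)" for n
    proof -
      have "(\<integral>x. h n x - g x \<partial>M) = - (\<integral>x. g x \<partial>M)"
        using integrable_if_sq_integrable[OF h(1)[of n]] integrable_if_sq_integrable[OF g(1)] h(2)[of n]
        by simp
      then have "\<bar>\<integral>x. g x \<partial>M\<bar> \<le> (\<integral>x. \<bar>h n x - g x\<bar> \<partial>M)"
        using integral_abs_bound[of M "\<lambda>x. h n x - g x"] by simp
      also have "\<dots> \<le> norm2 M (\<lambda>x. h n x - g x) * norm2 M (\<lambda>_. 1)"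
        by (rule integral_abs_le_norm2[OF sqhg])
      finally show ?thesis .
    qed
    moreover have "(\<lambda>n. norm2 M (\<lambda>x. h n x - g x) * norm2 M (\<lambda>_. 1)) \<longlonglongrightarrow> 0"
      using tendsto_mult_right[OF g(2)] by simp
    ultimately have "\<bar>\<integral>x. g x \<partial>M\<bar> \<le> 0" by (intro LIMSEQ_le_const) auto
    then show ?thesis by simp
  qed
  have fixed: "AE y in M. g y = kernel_op M k g y"
  proof -
    have sqDg: "sq_integrable M (?D g)" by (intro sq_integrable_diff g kernel_op_sq_integrable k)
    have "norm2 M (?D g) \<le> 1 / real (Suc n) + (1 + norm2 (M \<Otimes>\<^sub>M M) k) * norm2 M (\<lambda>x. h n x - g x)" for n
    proof -
      let ?e = "\<lambda>x. h n x - g x"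
      have sqDh: "sq_integrable M (?D (h n))" by (intro sq_integrable_diff h kernel_op_sq_integrable k)
      have sqK: "sq_integrable M (kernel_op M k ?e)" by (intro kernel_op_sq_integrable k sqhg)
      have ae: "AE y in M. ?D (h n) y - ?D g y = ?e y - kernel_op M k ?e y"
        using kernel_op_diff_right[OF k h(1)[of n] g(1)] by eventually_elim simp
      have "norm2 M (?D g) \<le> norm2 M (?D (h n)) + norm2 M (\<lambda>y. ?D g y - ?D (h n) y)"
        by (rule norm2_triangle_diff[OF sqDg sqDh])
      also have "norm2 M (\<lambda>y. ?D g y - ?D (h n) y) = norm2 M (\<lambda>y. ?D (h n) y - ?D g y)"
        by (rule norm2_minus_commute)
      also have "\<dots> = norm2 M (\<lambda>y. ?e y - kernel_op M k ?e y)"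
        by (rule norm2_cong_AE[OF ae])
           (intro sq_integrable_measurable sq_integrable_diff sqDh sqDg h g sqK)+
      also have "\<dots> \<le> norm2 M ?e + norm2 M (kernel_op M k ?e)"
        by (rule norm2_diff_le[OF sqhg sqK])
      also have "norm2 M (kernel_op M k ?e) \<le> norm2 (M \<Otimes>\<^sub>M M) k * norm2 M ?e"
        by (rule kernel_op_sq_integrable[OF k sqhg])
      finally show ?thesis using Dh[of n] by (simp add: distrib_right)
    qed
    moreover have "(\<lambda>n. 1 / real (Suc n) + (1 + norm2 (M \<Otimes>\<^sub>M M) k) * norm2 M (\<lambda>x. h n x - g x)) \<longlonglongrightarrow> 0 + (1 + norm2 (M \<Otimes>\<^sub>M M) k) * 0"
      by (intro tendsto_add tendsto_mult_left g(2) LIMSEQ_Suc[OF lim_1_over_n])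
    ultimately have "norm2 M (?D g) \<le> 0 + (1 + norm2 (M \<Otimes>\<^sub>M M) k) * 0"
      by (intro LIMSEQ_le_const) auto
    then have "norm2 M (?D g) = 0" using norm2_nonneg[of M "?D g"] by linarith
    from norm2_eq_0_imp_AE[OF sqDg this] show ?thesis by eventually_elim simp
  qed
  have "AE y in M. g y = 0" by (rule inj[OF g(1) mean fixed])
  then have "norm2 M g = norm2 M (\<lambda>_. 0)"
    using g(1) by (intro norm2_cong_AE) (auto simp: sq_integrable_def)
  then have "norm2 M g = 0" by (simp add: norm2_def)
  then have "1 \<le> norm2 M (\<lambda>x. h n x - g x)" for n
    using norm2_triangle_diff[OF h(1)[of n] g(1)] h(3)[of n] by simp
  then have "1 \<le> (0::real)" using g(2) by (intro LIMSEQ_le_const) auto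
  then show False by simp
qed

end

section \<open>Comparison of the norms of orders two and p\<close>

text \<open>
  Comparing norms with a finite real \<open>c\<close> replaces the extended-valued case distinction by an almost
  everywhere bound for \<open>p = \<infinity>\<close> and by a bound on the integral of \<open>\<bar>f\<bar>\<^sup>p\<close> for finite \<open>p\<close>. All later
  estimates are stated in this form.
\<close>
lemma Lp_norm_top_le_iff:
  assumes "f \<in> borel_measurable M" "0 \<le> c"
  shows "Lp_norm M top f \<le> ennreal c \<longleftrightarrow> (AE x in M. \<bar>f x\<bar> \<le> c)"
proof
  assume le: "Lp_norm M top f \<le> ennreal c"
  show "AE x in M. \<bar>f x\<bar> \<le> c"
    using esssup_AE[of "\<lambda>x. ennreal \<bar>f x\<bar>" M]
  proof eventually_elim
    case (elim x)
    then have "ennreal \<bar>f x\<bar> \<le> ennreal c" using le by (simp add: Lp_norm_def)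
    then show ?case using assms(2) by simp
  qed
next
  assume "AE x in M. \<bar>f x\<bar> \<le> c"
  then show "Lp_norm M top f \<le> ennreal c"
    using assms by (auto simp: Lp_norm_def intro!: esssup_I)
qed

lemma Lp_norm_le_iff:
  assumes "p \<noteq> \<infinity>" "0 < enn2real p" "0 \<le> c"
  shows "Lp_norm M p f \<le> ennreal c \<longleftrightarrow>
    (\<integral>\<^sup>+x. ennreal (\<bar>f x\<bar> powr enn2real p) \<partial>M) \<le> ennreal (c powr enn2real p)"
proof -
  define r where "r = enn2real p"
  define I where "I = (\<integral>\<^sup>+x. ennreal (\<bar>f x\<bar> powr r) \<partial>M)"
  have r: "r > 0" using assms by (simp add: r_def)
  show ?thesis
  proof (cases "I = \<infinity>")
    case True
    then show ?thesis
      using assms(1) by (simp add: Lp_norm_def r_def[symmetric] I_def[symmetric] top_unique)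
  next
    case False
    then obtain i where i: "I = ennreal i" "0 \<le> i" by (cases I) auto
    have "i powr (1 / r) \<le> c \<longleftrightarrow> i \<le> c powr r"
    proof
      assume "i powr (1 / r) \<le> c"
      then have "(i powr (1 / r)) powr r \<le> c powr r" using r by (intro powr_mono2) auto
      then show "i \<le> c powr r" using r i by (simp add: powr_powr)
    next
      assume "i \<le> c powr r"
      then have "i powr (1 / r) \<le> (c powr r) powr (1 / r)" using r i by (intro powr_mono2) auto
      then show "i powr (1 / r) \<le> c" using r assms(3) by (simp add: powr_powr)
    qed
    then show ?thesis
      using assms(1,3) i by (simp add: Lp_norm_def r_def[symmetric] I_def[symmetric] Let_def)
  qed
qed

lemma enn2real_ge_2:
  assumes "2 \<le> p" "p \<noteq> \<infinity>"
  shows "2 \<le> enn2real p"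
proof -
  have "enn2real 2 \<le> enn2real p"
    using assms by (intro enn2real_mono) (auto simp: less_top)
  then show ?thesis by simp
qed

lemma Lp_norm_le_AE_mono:
  assumes "2 \<le> p" "0 \<le> c" "f \<in> borel_measurable M" "g \<in> borel_measurable M"
    and "AE x in M. \<bar>f x\<bar> \<le> \<bar>g x\<bar>" "Lp_norm M p g \<le> ennreal c"
  shows "Lp_norm M p f \<le> ennreal c"
proof (cases "p = \<infinity>")
  case True
  have "AE x in M. \<bar>g x\<bar> \<le> c"
    using assms(2,4,6) True by (simp add: Lp_norm_top_le_iff)
  with assms(5) have "AE x in M. \<bar>f x\<bar> \<le> c"
    by eventually_elim linarith
  then show ?thesis using assms(2,3) True by (simp add: Lp_norm_top_le_iff)
next
  case False
  note r = enn2real_ge_2[OF assms(1) False]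
  have "AE x in M. ennreal (\<bar>f x\<bar> powr enn2real p) \<le> ennreal (\<bar>g x\<bar> powr enn2real p)"
    using assms(5) by eventually_elim (use r in \<open>auto intro!: ennreal_leI powr_mono2\<close>)
  then have "(\<integral>\<^sup>+x. ennreal (\<bar>f x\<bar> powr enn2real p) \<partial>M) \<le> (\<integral>\<^sup>+x. ennreal (\<bar>g x\<bar> powr enn2real p) \<partial>M)"
    by (rule nn_integral_mono_AE)
  also have "\<dots> \<le> ennreal (c powr enn2real p)"
    using assms(2,6) False r by (subst Lp_norm_le_iff[symmetric]) auto
  finally show ?thesis using assms(2) False r by (subst Lp_norm_le_iff) auto
qed

lemma Lp_norm_le_cmult:
  assumes "2 \<le> p" "0 \<le> c" "0 \<le> t" "f \<in> borel_measurable M" "Lp_norm M p f \<le> ennreal c"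
  shows "Lp_norm M p (\<lambda>x. t * f x) \<le> ennreal (t * c)"
proof (cases "p = \<infinity>")
  case True
  have "AE x in M. \<bar>f x\<bar> \<le> c"
    using assms True by (simp add: Lp_norm_top_le_iff)
  then have "AE x in M. \<bar>t * f x\<bar> \<le> t * c"
    by eventually_elim (use assms in \<open>auto simp: abs_mult intro!: mult_left_mono\<close>)
  then show ?thesis using assms True by (simp add: Lp_norm_top_le_iff)
next
  case False
  note r = enn2real_ge_2[OF assms(1) False]
  have [measurable]: "f \<in> borel_measurable M" by fact
  have "(\<integral>\<^sup>+x. ennreal (\<bar>t * f x\<bar> powr enn2real p) \<partial>M)
      = ennreal (t powr enn2real p) * (\<integral>\<^sup>+x. ennreal (\<bar>f x\<bar> powr enn2real p) \<partial>M)"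
    using assms(3) by (subst nn_integral_cmult[symmetric]) (auto simp: abs_mult powr_mult ennreal_mult)
  also have "\<dots> \<le> ennreal (t powr enn2real p) * ennreal (c powr enn2real p)"
    using assms(2,5) False r by (intro mult_left_mono, subst Lp_norm_le_iff[symmetric]) auto
  also have "\<dots> = ennreal ((t * c) powr enn2real p)"
    using assms by (simp add: powr_mult ennreal_mult)
  finally show ?thesis using assms False r by (subst Lp_norm_le_iff) auto
qed

lemma powr_superadditive:
  assumes "0 \<le> a" "0 \<le> b" "1 \<le> r"
  shows "a powr r + b powr r \<le> (a + b) powr (r::real)"
proof -
  have *: "x * x powr (r - 1) = x powr r" if "0 \<le> x" for x
    using powr_mult_base[OF that, of "r - 1"] by simp
  have "a * a powr (r - 1) + b * b powr (r - 1) \<le> a * (a + b) powr (r - 1) + b * (a + b) powr (r - 1)"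
    using assms by (intro add_mono mult_left_mono powr_mono2) auto
  also have "\<dots> = (a + b) * (a + b) powr (r - 1)" by (simp add: distrib_right)
  finally show ?thesis using assms by (simp add: *)
qed

text \<open>
  A quasi-triangle inequality: the factor \<open>2\<close> comes from
  \<open>\<bar>u + v\<bar> \<le> 2 * max \<bar>u\<bar> \<bar>v\<bar>\<close>, which replaces the convexity argument of Minkowski's inequality.
\<close>
lemma Lp_norm_le_add:
  assumes "2 \<le> p" "0 \<le> a" "0 \<le> b" "f \<in> borel_measurable M" "g \<in> borel_measurable M"
    and "Lp_norm M p f \<le> ennreal a" "Lp_norm M p g \<le> ennreal b"
  shows "Lp_norm M p (\<lambda>x. f x + g x) \<le> ennreal (2 * (a + b))"
proof (cases "p = \<infinity>")
  case True
  have "AE x in M. \<bar>f x\<bar> \<le> a" "AE x in M. \<bar>g x\<bar> \<le> b"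
    using assms True by (simp_all add: Lp_norm_top_le_iff)
  then have "AE x in M. \<bar>f x + g x\<bar> \<le> 2 * (a + b)"
    by eventually_elim (use assms in auto)
  then show ?thesis
    unfolding True infinity_ennreal_def using assms(2-5) by (subst Lp_norm_top_le_iff) auto
next
  case False
  define r where "r = enn2real p"
  have r: "2 \<le> r" using enn2real_ge_2[OF assms(1) False] by (simp add: r_def)
  have [measurable]: "f \<in> borel_measurable M" "g \<in> borel_measurable M" by fact+
  have le: "\<bar>u + v\<bar> powr r \<le> 2 powr r * (\<bar>u\<bar> powr r + \<bar>v\<bar> powr r)" for u v :: real
  proof -
    have "\<bar>u + v\<bar> powr r \<le> (2 * max \<bar>u\<bar> \<bar>v\<bar>) powr r"
      using r by (intro powr_mono2) auto
    also have "\<dots> = 2 powr r * max \<bar>u\<bar> \<bar>v\<bar> powr r"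
      by (simp add: powr_mult)
    also have "max \<bar>u\<bar> \<bar>v\<bar> powr r \<le> \<bar>u\<bar> powr r + \<bar>v\<bar> powr r"
      by (simp add: max_def)
    finally show ?thesis by simp
  qed
  have "(\<integral>\<^sup>+x. ennreal (\<bar>f x + g x\<bar> powr r) \<partial>M)
      \<le> (\<integral>\<^sup>+x. ennreal (2 powr r) * (ennreal (\<bar>f x\<bar> powr r) + ennreal (\<bar>g x\<bar> powr r)) \<partial>M)"
    using le by (intro nn_integral_mono) (simp add: ennreal_mult[symmetric] ennreal_plus[symmetric] del: ennreal_plus)
  also have "\<dots> = ennreal (2 powr r) *
      ((\<integral>\<^sup>+x. ennreal (\<bar>f x\<bar> powr r) \<partial>M) + (\<integral>\<^sup>+x. ennreal (\<bar>g x\<bar> powr r) \<partial>M))"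
    by (subst nn_integral_cmult) (auto simp: nn_integral_add)
  also have "\<dots> \<le> ennreal (2 powr r) * (ennreal (a powr r) + ennreal (b powr r))"
    using assms False r unfolding r_def
    by (intro mult_left_mono add_mono) (subst Lp_norm_le_iff[symmetric], auto)+
  also have "\<dots> = ennreal (2 powr r * (a powr r + b powr r))"
    by (simp add: ennreal_mult)
  also have "\<dots> \<le> ennreal ((2 * (a + b)) powr r)"
    unfolding powr_mult
    using assms r powr_superadditive[of a b r] by (intro ennreal_leI mult_left_mono) auto
  finally show ?thesis using assms False r by (subst Lp_norm_le_iff) (auto simp: r_def)
qed

context finite_measure
begin

text \<open>
  A bound for the norm of the inclusion \<open>L\<^sup>p \<subseteq> L\<^sup>2\<close>, simultaneously for all \<open>2 \<le> p \<le> \<infinity>\<close>. It is not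
  optimal: Hoelder's inequality gives \<open>\<mu>(M)\<^bsup>1/2 - 1/p\<^esup>\<close>.
\<close>
definition L2_embedding_const :: real where
  "L2_embedding_const = sqrt (measure M (space M) + 1)"

lemma L2_embedding_const_pos: "0 < L2_embedding_const"
  by (simp add: L2_embedding_const_def add_nonneg_pos)

text \<open>
  Integrate \<open>u\<^sup>2 \<le> c\<^sup>2 + c\<^bsup>2 - r\<^esup> \<bar>u\<bar>\<^sup>r\<close>, which holds because \<open>\<bar>u\<bar> \<le> c\<close> or \<open>\<bar>u\<bar>\<^bsup>2 - r\<^esup> \<le> c\<^bsup>2 - r\<^esup>\<close>. With \<open>c\<close> a
  bound for the norm of order \<open>r\<close>, both summands have the size \<open>c\<^sup>2\<close>.
\<close>
lemma nn_integral_square_le_powr: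
  assumes [measurable]: "f \<in> borel_measurable M" and "2 \<le> r" "0 \<le> c"
    and le: "(\<integral>\<^sup>+x. ennreal (\<bar>f x\<bar> powr r) \<partial>M) \<le> ennreal (c powr r)"
  shows "(\<integral>\<^sup>+x. ennreal ((f x)\<^sup>2) \<partial>M) \<le> ennreal ((L2_embedding_const * c)\<^sup>2)"
proof (cases "c = 0")
  case True
  then have "AE x in M. ennreal (\<bar>f x\<bar> powr r) = 0"
    using le by (subst nn_integral_0_iff_AE[symmetric]) auto
  then have "AE x in M. ennreal ((f x)\<^sup>2) = 0"
    by eventually_elim (simp add: ennreal_eq_0_iff)
  then have "(\<integral>\<^sup>+x. ennreal ((f x)\<^sup>2) \<partial>M) = 0"
    by (subst nn_integral_0_iff_AE) auto
  then show ?thesis by simp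
next
  case False
  then have c: "c > 0" using assms by simp
  have young: "u\<^sup>2 \<le> c\<^sup>2 + c powr (2 - r) * \<bar>u\<bar> powr r" for u
  proof (cases "\<bar>u\<bar> \<le> c")
    case True
    then have "u\<^sup>2 \<le> c\<^sup>2" using c by (metis abs_le_square_iff abs_of_pos)
    then show ?thesis by (simp add: add_increasing2)
  next
    case False
    then have "u\<^sup>2 = \<bar>u\<bar> powr (2 - r) * \<bar>u\<bar> powr r"
      using c by (simp add: powr_add[symmetric])
    also have "\<dots> \<le> c powr (2 - r) * \<bar>u\<bar> powr r"
      using False c assms(2) by (intro mult_right_mono powr_mono2') auto
    finally show ?thesis by (simp add: add_increasing)
  qed
  have "(\<integral>\<^sup>+x. ennreal ((f x)\<^sup>2) \<partial>M)
      \<le> (\<integral>\<^sup>+x. ennreal (c\<^sup>2) + ennreal (c powr (2 - r)) * ennreal (\<bar>f x\<bar> powr r) \<partial>M)"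
    using young by (intro nn_integral_mono) (simp add: ennreal_mult[symmetric] ennreal_plus[symmetric] del: ennreal_plus)
  also have "\<dots> = ennreal (c\<^sup>2) * emeasure M (space M)
      + ennreal (c powr (2 - r)) * (\<integral>\<^sup>+x. ennreal (\<bar>f x\<bar> powr r) \<partial>M)"
    by (simp add: nn_integral_add nn_integral_cmult)
  also have "\<dots> \<le> ennreal (c\<^sup>2) * ennreal (measure M (space M)) + ennreal (c powr (2 - r)) * ennreal (c powr r)"
    unfolding emeasure_eq_measure by (intro add_mono mult_left_mono le) auto
  also have "\<dots> = ennreal (c\<^sup>2 * measure M (space M) + c powr (2 - r) * c powr r)"
    by (simp add: ennreal_mult)
  also have "c powr (2 - r) * c powr r = c\<^sup>2"
    using c by (simp add: powr_add[symmetric])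
  also have "c\<^sup>2 * measure M (space M) + c\<^sup>2 = (L2_embedding_const * c)\<^sup>2"
    by (simp add: L2_embedding_const_def power_mult_distrib algebra_simps)
  finally show ?thesis .
qed

lemma nn_integral_square_le_AE_bound:
  assumes [measurable]: "f \<in> borel_measurable M" and "0 \<le> c" "AE x in M. \<bar>f x\<bar> \<le> c"
  shows "(\<integral>\<^sup>+x. ennreal ((f x)\<^sup>2) \<partial>M) \<le> ennreal ((L2_embedding_const * c)\<^sup>2)"
proof -
  have "(\<integral>\<^sup>+x. ennreal ((f x)\<^sup>2) \<partial>M) \<le> (\<integral>\<^sup>+x. ennreal (c\<^sup>2) \<partial>M)"
    using assms(3)
    by (intro nn_integral_mono_AE, eventually_elim)
       (metis abs_ge_zero ennreal_leI power2_abs power_mono)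
  also have "\<dots> = ennreal (c\<^sup>2 * measure M (space M))"
    by (simp add: emeasure_eq_measure ennreal_mult)
  also have "\<dots> \<le> ennreal ((L2_embedding_const * c)\<^sup>2)"
    by (intro ennreal_leI) (simp add: L2_embedding_const_def power_mult_distrib algebra_simps)
  finally show ?thesis .
qed

lemma norm2_le_if_nn_integral_le:
  assumes [measurable]: "f \<in> borel_measurable M" and "0 \<le> c"
    and le: "(\<integral>\<^sup>+x. ennreal ((f x)\<^sup>2) \<partial>M) \<le> ennreal (c\<^sup>2)"
  shows "sq_integrable M f" "norm2 M f \<le> c"
proof -
  show sq: "sq_integrable M f"
    unfolding sq_integrable_def
  proof
    show "integrable M (\<lambda>x. (f x)\<^sup>2)"
      by (rule integrableI_bounded) (use le_less_trans[OF le ennreal_less_top] in simp_all)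
  qed fact
  show "norm2 M f \<le> c"
    using le nn_integral_square[OF sq] assms(2) power2_le_imp_le[of "norm2 M f" c] by simp
qed

lemma L2_norm_le_Lp_norm:
  assumes "2 \<le> p" "0 \<le> c" "f \<in> borel_measurable M" "Lp_norm M p f \<le> ennreal c"
  shows "sq_integrable M f" "norm2 M f \<le> L2_embedding_const * c"
proof -
  have "(\<integral>\<^sup>+x. ennreal ((f x)\<^sup>2) \<partial>M) \<le> ennreal ((L2_embedding_const * c)\<^sup>2)"
  proof (cases "p = \<infinity>")
    case True
    then have "AE x in M. \<bar>f x\<bar> \<le> c"
      using assms by (simp add: Lp_norm_top_le_iff)
    then show ?thesis by (intro nn_integral_square_le_AE_bound assms)
  next
    case False
    note r = enn2real_ge_2[OF assms(1) False]
    show ?thesis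
      using r assms False by (intro nn_integral_square_le_powr[OF _ r]) (auto simp: Lp_norm_le_iff[symmetric])
  qed
  moreover have "0 \<le> L2_embedding_const * c" using L2_embedding_const_pos assms(2) by simp
  ultimately show "sq_integrable M f" "norm2 M f \<le> L2_embedding_const * c"
    using norm2_le_if_nn_integral_le[OF assms(3)] by auto
qed

lemma Lp_space_imp_sq_integrable:
  assumes "2 \<le> p" "f \<in> Lp_space M p"
  shows "sq_integrable M f"
proof -
  obtain c where "Lp_norm M p f = ennreal c" "0 \<le> c"
    using assms(2) by (cases "Lp_norm M p f") (auto simp: Lp_space_def)
  then show ?thesis
    using assms by (intro L2_norm_le_Lp_norm(1)[of p c]) (auto simp: Lp_space_def)
qed

lemma column_norm_measurable[measurable]:
  assumes [measurable]: "k \<in> borel_measurable (M \<Otimes>\<^sub>M M)"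
  shows "column_norm M k \<in> borel_measurable M"
  unfolding column_norm_def norm2_def by measurable

text \<open>
  The embedding of \<open>L\<^sup>p\<close> into \<open>L\<^sup>2\<close> is applied to each column, and the resulting bound is integrated
  over the columns by Tonelli's theorem.
\<close>
lemma Lp_norm_column_norm_le:
  assumes "2 \<le> p" "0 \<le> c" and k[measurable]: "k \<in> borel_measurable (M \<Otimes>\<^sub>M M)"
    and le: "Lp_norm (M \<Otimes>\<^sub>M M) p k \<le> ennreal c"
  shows "Lp_norm M p (column_norm M k) \<le> ennreal (L2_embedding_const * c)"
proof -
  interpret P: pair_sigma_finite M M by (rule pair_sigma_finite_self)
  let ?K = "L2_embedding_const"
  have K: "0 < ?K" by (rule L2_embedding_const_pos)
  have sec: "(\<lambda>x. k (x, y)) \<in> borel_measurable M" if "y \<in> space M" for y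
    using that by measurable
  show ?thesis
  proof (cases "p = \<infinity>")
    case True
    have "AE z in M \<Otimes>\<^sub>M M. \<bar>k (fst z, snd z)\<bar> \<le> c"
      using le True assms by (simp add: Lp_norm_top_le_iff)
    then have "AE x in M. AE y in M. \<bar>k (x, y)\<bar> \<le> c"
      using P.AE_pair[of "\<lambda>z. \<bar>k (fst z, snd z)\<bar> \<le> c"] by simp
    then have "AE y in M. AE x in M. \<bar>k (x, y)\<bar> \<le> c"
      by (subst P.AE_commute[symmetric]) auto
    then have "AE y in M. column_norm M k y \<le> ?K * c"
      using AE_space
    proof eventually_elim
      case (elim y)
      show ?case
        unfolding column_norm_def using assms(2) K
        by (intro norm2_le_if_nn_integral_le sec nn_integral_square_le_AE_bound elim) auto
    qed
    then show ?thesis using True K assms(2) by (simp add: Lp_norm_top_le_iff)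
  next
    case False
    define r where "r = enn2real p"
    have r: "2 \<le> r" using enn2real_ge_2[OF assms(1) False] by (simp add: r_def)
    have col: "ennreal (\<bar>column_norm M k y\<bar> powr r)
        \<le> ennreal (?K powr r) * (\<integral>\<^sup>+x. ennreal (\<bar>k (x, y)\<bar> powr r) \<partial>M)" if y: "y \<in> space M" for y
    proof (cases "(\<integral>\<^sup>+x. ennreal (\<bar>k (x, y)\<bar> powr r) \<partial>M)")
      case top
      then show ?thesis using K by (simp add: ennreal_mult_top)
    next
      case (real j)
      have j: "(j powr (1 / r)) powr r = j" using real r by (simp add: powr_powr)
      have "column_norm M k y \<le> ?K * j powr (1 / r)"
        unfolding column_norm_def using K r real j
        by (intro norm2_le_if_nn_integral_le sec y nn_integral_square_le_powr[OF _ r]) auto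
      then have "\<bar>column_norm M k y\<bar> powr r \<le> (?K * j powr (1 / r)) powr r"
        using r by (intro powr_mono2) auto
      also have "\<dots> = ?K powr r * j" using K j by (simp add: powr_mult)
      finally show ?thesis
        using K real by (simp add: ennreal_mult[symmetric])
    qed
    have "(\<integral>\<^sup>+y. ennreal (\<bar>column_norm M k y\<bar> powr r) \<partial>M)
        \<le> (\<integral>\<^sup>+y. ennreal (?K powr r) * (\<integral>\<^sup>+x. ennreal (\<bar>k (x, y)\<bar> powr r) \<partial>M) \<partial>M)"
      by (intro nn_integral_mono col)
    also have "\<dots> = ennreal (?K powr r) * (\<integral>\<^sup>+y. \<integral>\<^sup>+x. ennreal (\<bar>k (x, y)\<bar> powr r) \<partial>M \<partial>M)"
      by (rule nn_integral_cmult) measurable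
    also have "(\<integral>\<^sup>+y. \<integral>\<^sup>+x. ennreal (\<bar>k (x, y)\<bar> powr r) \<partial>M \<partial>M)
        = (\<integral>\<^sup>+z. ennreal (\<bar>k z\<bar> powr r) \<partial>(M \<Otimes>\<^sub>M M))"
      by (rule P.nn_integral_snd[of "\<lambda>z. ennreal (\<bar>k z\<bar> powr r)"]) measurable
    also have "\<dots> \<le> ennreal (c powr r)"
      using le False r assms(2) by (subst (asm) Lp_norm_le_iff) (auto simp: r_def)
    also have "ennreal (?K powr r) * ennreal (c powr r) = ennreal ((?K * c) powr r)"
      using K assms(2) by (simp add: powr_mult ennreal_mult)
    finally show ?thesis
      using False r K assms(2) by (subst Lp_norm_le_iff) (auto simp: r_def mult_left_mono)
  qed
qed

end

section \<open>Mass-preserving kernels\<close>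

context finite_measure
begin

lemma kernel_op_eq_nn_integral:
  assumes "sq_integrable (M \<Otimes>\<^sub>M M) k" "sq_integrable M f"
    and "AE x in M. 0 \<le> f x" "\<And>x y. x \<in> space M \<Longrightarrow> y \<in> space M \<Longrightarrow> 0 \<le> k (x, y)"
  shows "AE y in M. ennreal (kernel_op M k f y) = (\<integral>\<^sup>+x. ennreal (f x) * ennreal (k (x, y)) \<partial>M)"
  using AE_sq_integrable_column[OF assms(1)] AE_space
proof eventually_elim
  case (elim y)
  have nonneg: "AE x in M. 0 \<le> k (x, y) * f x"
    using assms(3) AE_space by eventually_elim (simp add: assms(4) elim(2))
  have "ennreal (kernel_op M k f y) = (\<integral>\<^sup>+x. ennreal (k (x, y) * f x) \<partial>M)"
    unfolding kernel_op_def
    using nonneg by (intro nn_integral_eq_integral[symmetric] sq_integrable_mult elim assms)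
  also have "\<dots> = (\<integral>\<^sup>+x. ennreal (f x) * ennreal (k (x, y)) \<partial>M)"
    using assms(3) AE_space
    by (intro nn_integral_cong_AE, eventually_elim) (simp add: ennreal_mult assms(4) elim(2) mult.commute)
  finally show ?case .
qed

lemma kernel_op_add_right:
  assumes "sq_integrable (M \<Otimes>\<^sub>M M) k" "sq_integrable M f" "sq_integrable M g"
  shows "AE y in M. kernel_op M k (\<lambda>x. f x + g x) y = kernel_op M k f y + kernel_op M k g y"
  using AE_sq_integrable_column[OF assms(1)]
  by eventually_elim (simp add: kernel_op_def distrib_left sq_integrable_mult assms)

text \<open>
  Tonelli's theorem integrates the second variable first, where the kernel has total mass one.
\<close>
lemma kernel_op_integral:
  assumes k: "sq_integrable (M \<Otimes>\<^sub>M M) k" and f: "sq_integrable M f" "\<And>x. 0 \<le> f x"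
    and nonneg: "\<And>x y. x \<in> space M \<Longrightarrow> y \<in> space M \<Longrightarrow> 0 \<le> k (x, y)"
    and mass: "\<And>x. x \<in> space M \<Longrightarrow> (\<integral>\<^sup>+y. ennreal (k (x, y)) \<partial>M) = 1"
  shows "(\<integral>y. kernel_op M k f y \<partial>M) = (\<integral>x. f x \<partial>M)"
proof -
  interpret P: pair_sigma_finite M M by (rule pair_sigma_finite_self)
  have [measurable]: "k \<in> borel_measurable (M \<Otimes>\<^sub>M M)" "f \<in> borel_measurable M"
    using k f by (auto simp: sq_integrable_def)
  have sqK: "sq_integrable M (kernel_op M k f)" by (rule kernel_op_sq_integrable[OF k f(1)])
  have pos: "0 \<le> kernel_op M k f y" if "y \<in> space M" for y
    unfolding kernel_op_def using f(2) nonneg that by (intro Bochner_Integration.integral_nonneg) auto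
  have "ennreal (\<integral>y. kernel_op M k f y \<partial>M) = (\<integral>\<^sup>+y. ennreal (kernel_op M k f y) \<partial>M)"
    using pos by (intro nn_integral_eq_integral[symmetric] integrable_if_sq_integrable sqK) auto
  also have "\<dots> = (\<integral>\<^sup>+y. \<integral>\<^sup>+x. ennreal (f x) * ennreal (k (x, y)) \<partial>M \<partial>M)"
    using f(2) by (intro nn_integral_cong_AE kernel_op_eq_nn_integral k f nonneg) auto
  also have "\<dots> = (\<integral>\<^sup>+x. \<integral>\<^sup>+y. ennreal (f x) * ennreal (k (x, y)) \<partial>M \<partial>M)"
    by (rule P.Fubini') measurable
  also have "\<dots> = (\<integral>\<^sup>+x. ennreal (f x) \<partial>M)"
  proof (rule nn_integral_cong)
    fix x assume x: "x \<in> space M"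
    have "(\<integral>\<^sup>+y. ennreal (f x) * ennreal (k (x, y)) \<partial>M) = ennreal (f x) * (\<integral>\<^sup>+y. ennreal (k (x, y)) \<partial>M)"
      using x by (intro nn_integral_cmult) measurable
    then show "(\<integral>\<^sup>+y. ennreal (f x) * ennreal (k (x, y)) \<partial>M) = ennreal (f x)"
      using mass[OF x] by simp
  qed
  also have "\<dots> = ennreal (\<integral>x. f x \<partial>M)"
    using f by (intro nn_integral_eq_integral integrable_if_sq_integrable) auto
  finally show ?thesis
    using pos f(2) by (subst (asm) ennreal_inj) (auto intro!: Bochner_Integration.integral_nonneg)
qed

text \<open>
  The triangle inequality gives \<open>\<bar>g\<bar> \<le> K \<bar>g\<bar>\<close>, and both sides have the same integral, so they
  agree almost everywhere.
\<close>
lemma fixed_point_abs: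
  assumes k: "sq_integrable (M \<Otimes>\<^sub>M M) k"
    and nonneg: "\<And>x y. x \<in> space M \<Longrightarrow> y \<in> space M \<Longrightarrow> 0 \<le> k (x, y)"
    and mass: "\<And>x. x \<in> space M \<Longrightarrow> (\<integral>\<^sup>+y. ennreal (k (x, y)) \<partial>M) = 1"
    and g: "sq_integrable M g" "AE y in M. g y = kernel_op M k g y"
  shows "AE y in M. \<bar>g y\<bar> = kernel_op M k (\<lambda>x. \<bar>g x\<bar>) y"
proof -
  have sq: "sq_integrable M (\<lambda>x. \<bar>g x\<bar>)" using g(1) by (auto simp: sq_integrable_def)
  have sqK: "sq_integrable M (kernel_op M k (\<lambda>x. \<bar>g x\<bar>))" by (rule kernel_op_sq_integrable[OF k sq])
  let ?d = "\<lambda>y. kernel_op M k (\<lambda>x. \<bar>g x\<bar>) y - \<bar>g y\<bar>"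
  have pos: "AE y in M. 0 \<le> ?d y"
    using g(2) AE_space
  proof eventually_elim
    case (elim y)
    have "\<bar>kernel_op M k g y\<bar> \<le> (\<integral>x. \<bar>k (x, y) * g x\<bar> \<partial>M)"
      unfolding kernel_op_def by (rule integral_abs_bound)
    also have "\<dots> = kernel_op M k (\<lambda>x. \<bar>g x\<bar>) y"
      unfolding kernel_op_def
      by (intro Bochner_Integration.integral_cong) (auto simp: abs_mult nonneg elim(2))
    finally show ?case using elim(1) by simp
  qed
  have int: "integrable M ?d"
    by (intro Bochner_Integration.integrable_diff integrable_if_sq_integrable sq sqK)
  have "(\<integral>y. ?d y \<partial>M) = 0"
    using kernel_op_integral[OF k sq _ nonneg mass] integrable_if_sq_integrable[OF sq]
      integrable_if_sq_integrable[OF sqK] by simp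
  then have "AE y in M. ?d y = 0"
    using integral_nonneg_eq_0_iff_AE[OF int pos] by simp
  then show ?thesis by eventually_elim simp
qed

end

section \<open>Invariant densities as fixed points\<close>

lemma finite_measure_leb_on:
  assumes "D \<in> sets borel" "emeasure lborel D < \<infinity>"
  shows "finite_measure (leb_on D)"
  using assms by (intro finite_measureI) (simp add: emeasure_restrict_space space_restrict_space)

lemma transition_op_density:
  assumes D: "D \<in> sets borel" and Q: "transition_density D Q"
    and h[measurable]: "h \<in> borel_measurable (leb_on D)" and prob: "prob_space (density (leb_on D) h)"
  shows "transition_op D Q (density (leb_on D) h)
    = density (leb_on D) (\<lambda>y. \<integral>\<^sup>+x. h x * ennreal (Q x y) \<partial>leb_on D)"
proof (rule measure_eqI)
  let ?M = "leb_on D"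
  have sf: "sigma_finite_measure ?M"
    by (rule sigma_finite_measure_restrict_space)
       (use D in \<open>simp_all add: lborel.sigma_finite_measure_axioms\<close>)
  interpret P: pair_sigma_finite ?M ?M by (intro pair_sigma_finite.intro sf)
  interpret sigma_finite_measure ?M by (rule sf)
  have Qm[measurable]: "case_prod Q \<in> borel_measurable (?M \<Otimes>\<^sub>M ?M)"
    using Q by (simp add: transition_density_def)
  have sec[measurable]: "Q x \<in> borel_measurable ?M" if "x \<in> D" for x
    using measurable_Pair2[OF Qm, of x] that by (simp add: space_restrict_space)
  have inP: "density ?M h \<in> space (prob_algebra ?M)"
    using prob by (simp add: space_prob_algebra)
  show sets: "sets (transition_op D Q (density ?M h))
      = sets (density ?M (\<lambda>y. \<integral>\<^sup>+x. h x * ennreal (Q x y) \<partial>?M))"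
    unfolding transition_op_def
    using sets_bind'[OF inP measurable_transition_kernel[OF D Q]] by simp
  fix A assume "A \<in> sets (transition_op D Q (density ?M h))"
  then have A[measurable]: "A \<in> sets ?M" by (simp add: sets)
  have k: "emeasure (transition_kernel D Q x) A = (\<integral>\<^sup>+y. ennreal (Q x y) * indicator A y \<partial>?M)"
    if "x \<in> D" for x
    using that A sec[OF that] by (simp add: transition_kernel_def emeasure_density)
  have km[measurable]: "(\<lambda>x. \<integral>\<^sup>+y. ennreal (Q x y) * indicator A y \<partial>?M) \<in> borel_measurable ?M"
    by measurable
  have "emeasure (transition_op D Q (density ?M h)) A
      = (\<integral>\<^sup>+x. emeasure (transition_kernel D Q x) A \<partial>density ?M h)"
    by (rule emeasure_transition_op[OF D Q prob _ A]) simp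
  also have "\<dots> = (\<integral>\<^sup>+x. (\<integral>\<^sup>+y. ennreal (Q x y) * indicator A y \<partial>?M) \<partial>density ?M h)"
    by (intro nn_integral_cong k) (simp add: space_restrict_space)
  also have "\<dots> = (\<integral>\<^sup>+x. h x * (\<integral>\<^sup>+y. ennreal (Q x y) * indicator A y \<partial>?M) \<partial>?M)"
    by (rule nn_integral_density) measurable
  also have "\<dots> = (\<integral>\<^sup>+x. \<integral>\<^sup>+y. h x * (ennreal (Q x y) * indicator A y) \<partial>?M \<partial>?M)"
    by (intro nn_integral_cong nn_integral_cmult[symmetric])
       (use sec in \<open>auto simp: space_restrict_space\<close>)
  also have "\<dots> = (\<integral>\<^sup>+y. \<integral>\<^sup>+x. h x * (ennreal (Q x y) * indicator A y) \<partial>?M \<partial>?M)"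
    by (rule P.Fubini'[symmetric]) measurable
  also have "\<dots> = (\<integral>\<^sup>+y. (\<integral>\<^sup>+x. h x * ennreal (Q x y) \<partial>?M) * indicator A y \<partial>?M)"
    by (intro nn_integral_cong) (auto split: split_indicator)
  also have "\<dots> = emeasure (density ?M (\<lambda>y. \<integral>\<^sup>+x. h x * ennreal (Q x y) \<partial>?M)) A"
    by (rule emeasure_density[symmetric]) measurable
  finally show "emeasure (transition_op D Q (density ?M h)) A
      = emeasure (density ?M (\<lambda>y. \<integral>\<^sup>+x. h x * ennreal (Q x y) \<partial>?M)) A" .
qed

text \<open>
  The bridge between the measure-theoretic chain and the operator on \<open>L\<^sup>2\<close>. It serves in both
  directions: the given densities are fixed points, and conversely nonnegative fixed points give
  invariant measures to which uniqueness applies.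
\<close>
lemma invariant_density_iff:
  assumes D: "D \<in> sets borel" "emeasure lborel D < \<infinity>" and Q: "transition_density D Q"
    and sqQ: "sq_integrable (leb_on D \<Otimes>\<^sub>M leb_on D) (case_prod Q)"
    and h: "sq_integrable (leb_on D) h" "AE x in leb_on D. 0 \<le> h x"
    and prob: "prob_space (density (leb_on D) (\<lambda>x. ennreal (h x)))"
  shows "invariant_prob D Q (density (leb_on D) (\<lambda>x. ennreal (h x)))
    \<longleftrightarrow> (AE y in leb_on D. h y = kernel_op (leb_on D) (case_prod Q) h y)"
proof -
  let ?M = "leb_on D" and ?K = "kernel_op (leb_on D) (case_prod Q) h"
  let ?N = "\<lambda>y. \<integral>\<^sup>+x. ennreal (h x) * ennreal (Q x y) \<partial>?M"
  interpret finite_measure ?M by (rule finite_measure_leb_on[OF D])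
  have [measurable]: "h \<in> borel_measurable ?M" "case_prod Q \<in> borel_measurable (?M \<Otimes>\<^sub>M ?M)"
    using h(1) sqQ by (auto simp: sq_integrable_def)
  have nonneg: "\<And>x y. x \<in> space ?M \<Longrightarrow> y \<in> space ?M \<Longrightarrow> 0 \<le> case_prod Q (x, y)"
    using Q by (simp add: transition_density_def space_restrict_space)
  have K: "AE y in ?M. ennreal (?K y) = ?N y"
    using kernel_op_eq_nn_integral[OF sqQ h nonneg] by simp
  have Kpos: "AE y in ?M. 0 \<le> ?K y"
  proof (rule AE_I2)
    fix y assume y: "y \<in> space ?M"
    have "AE x in ?M. 0 \<le> case_prod Q (x, y) * h x"
      using h(2) AE_space by eventually_elim (use nonneg y in auto)
    then show "0 \<le> ?K y" unfolding kernel_op_def by (rule integral_nonneg_AE)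
  qed
  have "invariant_prob D Q (density ?M (\<lambda>x. ennreal (h x)))
      \<longleftrightarrow> density ?M ?N = density ?M (\<lambda>x. ennreal (h x))"
    using prob by (simp add: invariant_prob_def transition_op_density[OF D(1) Q _ prob])
  also have "\<dots> \<longleftrightarrow> (AE y in ?M. ?N y = ennreal (h y))"
    by (rule density_unique_iff) measurable
  also have "\<dots> \<longleftrightarrow> (AE y in ?M. h y = ?K y)"
  proof
    assume "AE y in ?M. ?N y = ennreal (h y)"
    then show "AE y in ?M. h y = ?K y"
      using K Kpos h(2) by eventually_elim (metis ennreal_inj)
  next
    assume "AE y in ?M. h y = ?K y"
    then show "AE y in ?M. ?N y = ennreal (h y)" using K by eventually_elim simp
  qed
  finally show ?thesis .
qed

lemma unique_invariant_nonneg_fixed_point: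
  assumes D: "D \<in> sets borel" "emeasure lborel D < \<infinity>" and P: "transition_density D P"
    and sqP: "sq_integrable (leb_on D \<Otimes>\<^sub>M leb_on D) (case_prod P)"
    and uniq: "unique_invariant_prob D P \<pi>" and dens: "has_leb_density D \<pi> pi_hat"
    and u: "sq_integrable (leb_on D) u" "\<And>x. 0 \<le> u x" "0 < (\<integral>x. u x \<partial>leb_on D)"
      "AE y in leb_on D. u y = kernel_op (leb_on D) (case_prod P) u y"
  shows "AE y in leb_on D. u y = (\<integral>x. u x \<partial>leb_on D) * pi_hat y"
proof -
  let ?M = "leb_on D"
  interpret finite_measure ?M by (rule finite_measure_leb_on[OF D])
  define I where "I = (\<integral>x. u x \<partial>?M)"
  have I: "0 < I" using u(3) by (simp add: I_def)
  define h where "h x = (1 / I) * u x" for x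
  have hpos: "0 \<le> h x" for x using I u(2) by (simp add: h_def)
  have sqh: "sq_integrable ?M h" unfolding h_def by (rule sq_integrable_cmult[OF u(1)])
  have [measurable]: "h \<in> borel_measurable ?M" "pi_hat \<in> borel_measurable ?M"
    using sqh dens by (auto simp: sq_integrable_def has_leb_density_def)
  have prob: "prob_space (density ?M (\<lambda>x. ennreal (h x)))"
  proof (rule prob_spaceI)
    have "(\<integral>\<^sup>+x. ennreal (h x) \<partial>?M) = ennreal (\<integral>x. h x \<partial>?M)"
      using hpos by (intro nn_integral_eq_integral integrable_if_sq_integrable sqh) auto
    also have "(\<integral>x. h x \<partial>?M) = 1" using I by (simp add: h_def I_def)
    finally show "emeasure (density ?M (\<lambda>x. ennreal (h x))) (space (density ?M (\<lambda>x. ennreal (h x)))) = 1"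
      by (simp add: emeasure_density cong: nn_integral_cong)
  qed
  have "AE y in ?M. h y = kernel_op ?M (case_prod P) h y"
    using u(4)
  proof eventually_elim
    case (elim y)
    have "kernel_op ?M (case_prod P) h y = (1 / I) * kernel_op ?M (case_prod P) u y"
      by (simp add: kernel_op_def h_def)
    then show ?case using elim by (simp add: h_def)
  qed
  then have "invariant_prob D P (density ?M (\<lambda>x. ennreal (h x)))"
    using hpos by (subst invariant_density_iff[OF D P sqP sqh _ prob]) auto
  then have "density ?M (\<lambda>x. ennreal (h x)) = \<pi>"
    using uniq by (simp add: unique_invariant_prob_def)
  then have "density ?M (\<lambda>x. ennreal (h x)) = density ?M (\<lambda>x. ennreal (pi_hat x))"
    using dens by (simp add: has_leb_density_def)
  then have "AE y in ?M. ennreal (h y) = ennreal (pi_hat y)"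
    by (subst (asm) density_unique_iff) auto
  moreover have "AE y in ?M. 0 \<le> pi_hat y" using dens by (simp add: has_leb_density_def)
  ultimately have "AE y in ?M. u y = I * pi_hat y"
  proof eventually_elim
    case (elim y)
    then have "h y = pi_hat y" using hpos by (metis ennreal_inj)
    then show ?case using I by (simp add: h_def field_simps)
  qed
  then show ?thesis by (simp add: I_def)
qed

text \<open>
  If \<open>g\<close> is not null, then \<open>\<bar>g\<bar>\<close> and \<open>\<bar>g\<bar> + g\<close> are nonnegative fixed points with the same positive
  integral, because \<open>g\<close> has mean zero; by uniqueness they coincide.
\<close>
lemma unique_invariant_imp_no_mean_zero_fixed_point:
  assumes D: "D \<in> sets borel" "emeasure lborel D < \<infinity>" and P: "transition_density D P"
    and sqP: "sq_integrable (leb_on D \<Otimes>\<^sub>M leb_on D) (case_prod P)"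
    and uniq: "unique_invariant_prob D P \<pi>" and dens: "has_leb_density D \<pi> pi_hat"
    and g: "sq_integrable (leb_on D) g" "(\<integral>x. g x \<partial>leb_on D) = 0"
      "AE y in leb_on D. g y = kernel_op (leb_on D) (case_prod P) g y"
  shows "AE y in leb_on D. g y = 0"
proof -
  let ?M = "leb_on D" and ?K = "kernel_op (leb_on D) (case_prod P)"
  interpret finite_measure ?M by (rule finite_measure_leb_on[OF D])
  have nonneg: "\<And>x y. x \<in> space ?M \<Longrightarrow> y \<in> space ?M \<Longrightarrow> 0 \<le> case_prod P (x, y)"
    and mass: "\<And>x. x \<in> space ?M \<Longrightarrow> (\<integral>\<^sup>+y. ennreal (case_prod P (x, y)) \<partial>?M) = 1"
    using P by (simp_all add: transition_density_def space_restrict_space)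
  have sqa: "sq_integrable ?M (\<lambda>x. \<bar>g x\<bar>)" using g(1) by (auto simp: sq_integrable_def)
  have abs: "AE y in ?M. \<bar>g y\<bar> = ?K (\<lambda>x. \<bar>g x\<bar>) y"
    by (rule fixed_point_abs[OF sqP nonneg mass g(1,3)])
  show ?thesis
  proof (cases "(\<integral>x. \<bar>g x\<bar> \<partial>?M) = 0")
    case True
    then have "AE x in ?M. \<bar>g x\<bar> = 0"
      using integral_nonneg_eq_0_iff_AE[OF integrable_if_sq_integrable[OF sqa]] by simp
    then show ?thesis by simp
  next
    case False
    moreover have "0 \<le> (\<integral>x. \<bar>g x\<bar> \<partial>?M)"
      by (rule Bochner_Integration.integral_nonneg) simp
    ultimately have I: "0 < (\<integral>x. \<bar>g x\<bar> \<partial>?M)" by linarith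
    have eq: "(\<integral>x. \<bar>g x\<bar> + g x \<partial>?M) = (\<integral>x. \<bar>g x\<bar> \<partial>?M)"
      using g(2) integrable_if_sq_integrable[OF sqa] integrable_if_sq_integrable[OF g(1)] by simp
    have fix2: "AE y in ?M. \<bar>g y\<bar> + g y = ?K (\<lambda>x. \<bar>g x\<bar> + g x) y"
      using abs g(3) kernel_op_add_right[OF sqP sqa g(1)] by eventually_elim simp
    have "AE y in ?M. \<bar>g y\<bar> = (\<integral>x. \<bar>g x\<bar> \<partial>?M) * pi_hat y"
      by (rule unique_invariant_nonneg_fixed_point[OF D P sqP uniq dens sqa _ I abs]) simp
    moreover have "AE y in ?M. \<bar>g y\<bar> + g y = (\<integral>x. \<bar>g x\<bar> + g x \<partial>?M) * pi_hat y"
      by (rule unique_invariant_nonneg_fixed_point[OF D P sqP uniq dens sq_integrable_add[OF sqa g(1)] _ _ fix2])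
         (use I eq in auto)
    ultimately show ?thesis unfolding eq by eventually_elim simp
  qed
qed

lemma invariant_density_integral:
  assumes "D \<in> sets borel" "emeasure lborel D < \<infinity>"
    and "prob_space \<mu>" "has_leb_density D \<mu> h" "sq_integrable (leb_on D) h"
  shows "(\<integral>x. h x \<partial>leb_on D) = 1"
proof -
  let ?M = "leb_on D"
  interpret finite_measure ?M by (rule finite_measure_leb_on[OF assms(1,2)])
  interpret mu: prob_space \<mu> by fact
  have h: "h \<in> borel_measurable ?M" "AE x in ?M. 0 \<le> h x" "\<mu> = density ?M (\<lambda>x. ennreal (h x))"
    using assms(4) by (auto simp: has_leb_density_def)
  have "ennreal (\<integral>x. h x \<partial>?M) = (\<integral>\<^sup>+x. ennreal (h x) \<partial>?M)"
    using h by (intro nn_integral_eq_integral[symmetric] integrable_if_sq_integrable assms) auto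
  also have "\<dots> = emeasure \<mu> (space \<mu>)"
    using h(1) unfolding h(3) by (simp add: emeasure_density cong: nn_integral_cong)
  also have "\<dots> = 1" by (rule mu.emeasure_space_1)
  finally show ?thesis by simp
qed

section \<open>Stability of the invariant density\<close>

theorem theorem4p3:
  fixes D :: "'a::euclidean_space set"
    and P :: "'a \<Rightarrow> 'a \<Rightarrow> real"
    and \<pi> :: "'a measure" and pi_hat :: "'a \<Rightarrow> real"
    and p :: ennreal
  assumes "D \<in> sets borel" "0 < emeasure lborel D" "emeasure lborel D < \<infinity>"
    and "transition_density D P"
    and "unique_invariant_prob D P \<pi>"
    and "has_leb_density D \<pi> pi_hat"
    and "ergodic_chain D P \<pi>"
    and "pi_hat \<in> Lp_space (leb_on D) 2"
    and "2 \<le> p"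
  shows "\<exists>\<delta>' C' :: real. \<delta>' > 0 \<and> C' > 0 \<and>
    (\<forall>(Q :: 'a \<Rightarrow> 'a \<Rightarrow> real) (\<eta> :: 'a measure) (eta_hat :: 'a \<Rightarrow> real).
       transition_density D Q \<longrightarrow>
       unique_invariant_prob D Q \<eta> \<longrightarrow>
       has_leb_density D \<eta> eta_hat \<longrightarrow>
       ergodic_chain D Q \<eta> \<longrightarrow>
       eta_hat \<in> Lp_space (leb_on D) 2 \<longrightarrow>
       case_prod P \<in> Lp_space (leb_on D \<Otimes>\<^sub>M leb_on D) p \<longrightarrow>
       case_prod Q \<in> Lp_space (leb_on D \<Otimes>\<^sub>M leb_on D) p \<longrightarrow>
       Lp_norm (leb_on D \<Otimes>\<^sub>M leb_on D) p (\<lambda>(x, y). P x y - Q x y) < ennreal \<delta>' \<longrightarrow>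
       Lp_norm (leb_on D) p (\<lambda>x. pi_hat x - eta_hat x)
         \<le> ennreal C' * Lp_norm (leb_on D \<Otimes>\<^sub>M leb_on D) p (\<lambda>(x, y). P x y - Q x y))"
proof (cases "case_prod P \<in> Lp_space (leb_on D \<Otimes>\<^sub>M leb_on D) p")
  case False
  \<comment> \<open>No \<open>Q\<close> satisfies the hypotheses.\<close>
  then show ?thesis by (intro exI[of _ 1]) auto
next
  case True
  let ?M = "leb_on D" and ?MM = "leb_on D \<Otimes>\<^sub>M leb_on D" and ?P = "\<lambda>z. case_prod P z"
  note D = assms(1,3)
  interpret M: finite_measure ?M by (rule finite_measure_leb_on[OF D])
  interpret MM: finite_measure ?MM by (rule M.finite_measure_pair_self)
  \<comment> \<open>From here on everything except \<open>main\<close> depends on \<open>D\<close>, \<open>P\<close>, \<open>p\<close> and \<open>pi_hat\<close> only.\<close>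
  have sqP: "sq_integrable ?MM ?P"
    by (rule MM.Lp_space_imp_sq_integrable[OF assms(9) True])
  have sqpi: "sq_integrable ?M pi_hat"
    by (rule M.Lp_space_imp_sq_integrable[OF _ assms(8)]) simp
  have "\<exists>C>0. \<forall>f. sq_integrable ?M f \<longrightarrow> (\<integral>x. f x \<partial>?M) = 0 \<longrightarrow>
      norm2 ?M f \<le> C * norm2 ?M (\<lambda>y. f y - kernel_op ?M ?P f y)"
    by (rule M.id_minus_kernel_op_bounded_below[OF sqP])
       (rule unique_invariant_imp_no_mean_zero_fixed_point[OF D assms(4) sqP assms(5,6)])
  then obtain C where C: "C > 0" "\<And>f. sq_integrable ?M f \<Longrightarrow> (\<integral>x. f x \<partial>?M) = 0 \<Longrightarrow>
      norm2 ?M f \<le> C * norm2 ?M (\<lambda>y. f y - kernel_op ?M ?P f y)" by blast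
  obtain N where N: "Lp_norm ?MM p ?P = ennreal N" "0 \<le> N"
    using True by (cases "Lp_norm ?MM p ?P") (auto simp: Lp_space_def)
  define c where "c = M.L2_embedding_const"
  define c2 where "c2 = MM.L2_embedding_const"
  have c: "0 < c" "0 < c2" by (simp_all add: c_def c2_def M.L2_embedding_const_pos MM.L2_embedding_const_pos)
  define n where "n = norm2 ?M pi_hat"
  have n: "0 \<le> n" by (simp add: n_def)
  \<comment> \<open>This choice makes \<open>C * norm2 (P - Q)\<close> at most \<open>1/2\<close> whenever the norm of order \<open>p\<close> is below \<open>\<delta>\<close>.\<close>
  define \<delta> where "\<delta> = 1 / (2 * C * c2)"
  define C' where "C' = 2 * (2 * C * c2 * n * (c * N) + 2 * n * c) + 1"
  have pos: "\<delta> > 0" "C' > 0"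
    using C(1) c n N(2) by (simp_all add: \<delta>_def C'_def add_nonneg_pos)
  have main: "Lp_norm ?M p (\<lambda>x. pi_hat x - eta_hat x)
      \<le> ennreal C' * Lp_norm ?MM p (\<lambda>(x, y). P x y - Q x y)"
    if Q: "transition_density D Q" and eta: "unique_invariant_prob D Q \<eta>" "has_leb_density D \<eta> eta_hat"
      "eta_hat \<in> Lp_space ?M 2" and Qp: "case_prod Q \<in> Lp_space ?MM p"
      and small: "Lp_norm ?MM p (\<lambda>(x, y). P x y - Q x y) < ennreal \<delta>"
    for Q \<eta> eta_hat
  proof -
    let ?\<Delta> = "\<lambda>z. case_prod P z - case_prod Q z"
    have \<Delta>: "(\<lambda>(x, y). P x y - Q x y) = ?\<Delta>" by (simp add: fun_eq_iff)
    obtain d where d: "Lp_norm ?MM p ?\<Delta> = ennreal d" "0 \<le> d" "d < \<delta>"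
      using small pos(1) unfolding \<Delta> by (cases "Lp_norm ?MM p ?\<Delta>") (auto simp: ennreal_less_iff)
    have sqQ: "sq_integrable ?MM (case_prod Q)"
      by (rule MM.Lp_space_imp_sq_integrable[OF assms(9) Qp])
    have sq\<Delta>: "sq_integrable ?MM ?\<Delta>" by (rule sq_integrable_diff[OF sqP sqQ])
    have norm\<Delta>: "norm2 ?MM ?\<Delta> \<le> c2 * d"
      unfolding c2_def using d
      by (intro MM.L2_norm_le_Lp_norm(2)[OF assms(9)] sq_integrable_measurable[OF sq\<Delta>]) auto
    have sqeta: "sq_integrable ?M eta_hat"
      by (rule M.Lp_space_imp_sq_integrable[OF _ eta(3)]) simp
    have prob: "prob_space \<pi>" "prob_space \<eta>" "invariant_prob D P \<pi>" "invariant_prob D Q \<eta>"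
      using assms(5) eta(1) by (auto simp: unique_invariant_prob_def invariant_prob_def)
    have pifix: "AE y in ?M. pi_hat y = kernel_op ?M ?P pi_hat y"
      using prob(1,3) assms(6) invariant_density_iff[OF D assms(4) sqP sqpi]
      by (auto simp: has_leb_density_def)
    have etafix: "AE y in ?M. eta_hat y = kernel_op ?M (case_prod Q) eta_hat y"
      using prob(2,4) eta(2) invariant_density_iff[OF D Q sqQ sqeta]
      by (auto simp: has_leb_density_def)
    let ?w = "\<lambda>x. pi_hat x - eta_hat x"
    have sqw: "sq_integrable ?M ?w" by (rule sq_integrable_diff[OF sqpi sqeta])
    have mean: "(\<integral>x. ?w x \<partial>?M) = 0"
      using invariant_density_integral[OF D prob(1) assms(6) sqpi]
        invariant_density_integral[OF D prob(2) eta(2) sqeta]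
        M.integrable_if_sq_integrable[OF sqpi] M.integrable_if_sq_integrable[OF sqeta] by simp
    have eq: "AE y in ?M. ?w y - kernel_op ?M ?P ?w y = kernel_op ?M ?\<Delta> eta_hat y"
      using pifix etafix M.kernel_op_diff_right[OF sqP sqpi sqeta] M.kernel_op_diff_left[OF sqP sqQ sqeta]
      by eventually_elim simp
    have "norm2 ?M ?w \<le> C * norm2 ?M (\<lambda>y. ?w y - kernel_op ?M ?P ?w y)"
      by (rule C(2)[OF sqw mean])
    also have "norm2 ?M (\<lambda>y. ?w y - kernel_op ?M ?P ?w y) = norm2 ?M (kernel_op ?M ?\<Delta> eta_hat)"
      by (rule norm2_cong_AE[OF eq])
         (intro sq_integrable_measurable sq_integrable_diff sqw M.kernel_op_sq_integrable(1) sqP sq\<Delta> sqeta)+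
    also have "\<dots> \<le> norm2 ?MM ?\<Delta> * norm2 ?M eta_hat"
      by (rule M.kernel_op_sq_integrable(2)[OF sq\<Delta> sqeta])
    also have "\<dots> \<le> c2 * d * norm2 ?M eta_hat"
      by (intro mult_right_mono norm\<Delta>) simp
    finally have w1: "norm2 ?M ?w \<le> C * (c2 * d * norm2 ?M eta_hat)"
      using C(1) by simp
    \<comment> \<open>A bound on \<open>eta_hat\<close> independent of \<open>Q\<close>, from \<open>\<parallel>\<eta>\<parallel> \<le> \<parallel>\<pi>\<parallel> + \<parallel>w\<parallel>\<close> and \<open>\<parallel>w\<parallel> \<le> \<parallel>\<eta>\<parallel> / 2\<close>.\<close>
    have "norm2 ?M eta_hat \<le> n + norm2 ?M ?w"
      using norm2_triangle_diff[OF sqeta sqpi] norm2_minus_commute[of ?M eta_hat pi_hat]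
      by (simp add: n_def)
    moreover have "norm2 ?M ?w \<le> 1/2 * norm2 ?M eta_hat"
    proof -
      have "C * (c2 * d) \<le> C * (c2 * \<delta>)" using C(1) c d by (intro mult_left_mono) auto
      also have "\<dots> = 1/2" using C(1) c by (simp add: \<delta>_def)
      finally have "C * (c2 * d) * norm2 ?M eta_hat \<le> 1/2 * norm2 ?M eta_hat"
        by (intro mult_right_mono) auto
      then show ?thesis using w1 by (simp add: mult.assoc)
    qed
    ultimately have eta_le: "norm2 ?M eta_hat \<le> 2 * n" by linarith
    have "C * (c2 * d * norm2 ?M eta_hat) \<le> C * (c2 * d * (2 * n))"
      using C(1) c d eta_le by (intro mult_left_mono) auto
    with w1 have w_le: "norm2 ?M ?w \<le> 2 * C * c2 * n * d" by (simp add: mult_ac)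
    have colP: "Lp_norm ?M p (column_norm ?M ?P) \<le> ennreal (c * N)"
      unfolding c_def using N
      by (intro M.Lp_norm_column_norm_le[OF assms(9)] sq_integrable_measurable[OF sqP]) auto
    have col\<Delta>: "Lp_norm ?M p (column_norm ?M ?\<Delta>) \<le> ennreal (c * d)"
      unfolding c_def using d
      by (intro M.Lp_norm_column_norm_le[OF assms(9)] sq_integrable_measurable[OF sq\<Delta>]) auto
    let ?A = "\<lambda>y. norm2 ?M ?w * column_norm ?M ?P y"
    let ?B = "\<lambda>y. norm2 ?M eta_hat * column_norm ?M ?\<Delta> y"
    have meas: "column_norm ?M ?P \<in> borel_measurable ?M" "column_norm ?M ?\<Delta> \<in> borel_measurable ?M"
      by (intro M.column_norm_measurable sq_integrable_measurable sqP sq\<Delta>)+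
    \<comment> \<open>The identity \<open>w = T w + (T - S) \<eta>\<close>, with both terms bounded column by column.\<close>
    have pw: "AE y in ?M. \<bar>?w y\<bar> \<le> \<bar>?A y + ?B y\<bar>"
      using eq M.kernel_op_le_column_norm[OF sqP sqw] M.kernel_op_le_column_norm[OF sq\<Delta> sqeta]
    proof eventually_elim
      case (elim y)
      have "\<bar>?w y\<bar> \<le> \<bar>kernel_op ?M ?P ?w y\<bar> + \<bar>kernel_op ?M ?\<Delta> eta_hat y\<bar>"
        using elim(1) by linarith
      also have "\<dots> \<le> ?A y + ?B y" using elim(2,3) by (simp add: mult.commute)
      finally show ?case by linarith
    qed
    have A: "Lp_norm ?M p ?A \<le> ennreal (norm2 ?M ?w * (c * N))"
      using c N by (intro Lp_norm_le_cmult[OF assms(9)] meas colP) auto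
    have B: "Lp_norm ?M p ?B \<le> ennreal (norm2 ?M eta_hat * (c * d))"
      using c d by (intro Lp_norm_le_cmult[OF assms(9)] meas col\<Delta>) auto
    have AB: "Lp_norm ?M p (\<lambda>y. ?A y + ?B y)
        \<le> ennreal (2 * (norm2 ?M ?w * (c * N) + norm2 ?M eta_hat * (c * d)))"
      using c N d meas by (intro Lp_norm_le_add[OF assms(9)] A B) auto
    have "Lp_norm ?M p ?w \<le> ennreal (2 * (norm2 ?M ?w * (c * N) + norm2 ?M eta_hat * (c * d)))"
      using c N d meas
      by (intro Lp_norm_le_AE_mono[OF assms(9) _ _ _ pw AB] sq_integrable_measurable[OF sqw]) auto
    also have "\<dots> \<le> ennreal (C' * d)"
    proof (rule ennreal_leI)
      have "norm2 ?M ?w * (c * N) \<le> 2 * C * c2 * n * d * (c * N)"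
        using c N by (intro mult_right_mono w_le) auto
      moreover have "norm2 ?M eta_hat * (c * d) \<le> 2 * n * (c * d)"
        using c d by (intro mult_right_mono eta_le) auto
      ultimately have "2 * (norm2 ?M ?w * (c * N) + norm2 ?M eta_hat * (c * d))
          \<le> 2 * (2 * C * c2 * n * d * (c * N) + 2 * n * (c * d))"
        by (intro mult_left_mono add_mono) auto
      also have "\<dots> \<le> C' * d"
        using d(2) by (simp add: C'_def algebra_simps)
      finally show "2 * (norm2 ?M ?w * (c * N) + norm2 ?M eta_hat * (c * d)) \<le> C' * d" .
    qed
    also have "\<dots> = ennreal C' * Lp_norm ?MM p (\<lambda>(x, y). P x y - Q x y)"
      unfolding \<Delta> d(1) using pos d by (simp add: ennreal_mult)
    finally show ?thesis .
  qed
  then show ?thesis using pos by blast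
qed

end
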